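(* Let $(\Omega,\mathscr{F},\mathbb{P})$ be a probability space and let $\{X_n\}_{n\ge0}$, $\{M_n\}_{n\ge1}$ be $\mathbb{R}^d$-valued random variables satisfying, for every $n\ge0$, $$X_{n+1}-X_n-a(n)M_{n+1}\in a(n)F(X_n),$$ where: (A1) $F$ maps each $x\in\mathbb{R}^d$ to a nonempty convex compact subset $F(x)\subseteq\mathbb{R}^d$; there is $K>0$ with $\sup_{y\in F(x)}\|y\|\le K(1+\|x\|)$ for all $x$; and $F$ has closed graph, i.e. whenever $x_n\to x$, $y_n\in F(x_n)$, $y_n\to y$, then $y\in F(x)$; (A2) $\{a(n)\}_{n\ge0}$ are positive reals with $\sum_n a(n)=\infty$ and $\sum_n a(n)^2<\infty$; (A3) $\{M_n\}_{n\ge1}$ is a martingale difference sequence with respect to $\mathscr{F}_n:=\sigma(X_m,M_m,\ m\le n)$, and $\|M_{n+1}\|\le K(1+\|X_n\|)$ a.s. for every $n\ge0$, for some constant $K>0$; (A4) $A\subseteq\mathbb{R}^d$ is an attracting set of the differential inclusion $\dot x\in F(x)$ with fundamental neighborhood $\mathcal{O}$. Let $\mathcal{O}'$ be an open neighborhood of $A$ with $\overline{\mathcal{O}'}$ compact and $\overline{\mathcal{O}'}\subseteq\mathcal{O}$. Then there exist a constant $\tilde K>0$ (depending on $A$ and $\mathcal{O}'$) and $N_0\ge1$ such that for every $n_0\ge N_0$ and every event $E\in\mathscr{F}_{n_0}$ with $E\subseteq\{X_{n_0}\in\mathcal{O}'\}$ and $\mathbb{P}(E)>0$, $$\mathbb{P}\big(X_n\to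 A \text{ as } n\to\infty\ \big|\ E\big)\ge 1-2d\,e^{-\tilde K/b(n_0)},\qquad b(n):=\sum_{k=n}^\infty a(k)^2 .$$
   Context: A solution of the differential inclusion $\dot x\in F(x)$ with initial condition $x_0$ is an absolutely continuous $\mathbf{x}:\mathbb{R}\to\mathbb{R}^d$ with $\mathbf{x}(0)=x_0$ and $\dot{\mathbf{x}}(t)\in F(\mathbf{x}(t))$ for a.e. $t$. Its flow is $\Phi(t,x):=\{\mathbf{x}(t):\mathbf{x}\text{ a solution with }\mathbf{x}(0)=x\}$. A compact set $A$ is an attracting set if there is an open neighborhood $\mathcal{O}$ of $A$ (a fundamental neighborhood) such that for every $\epsilon>0$ there is $T>0$ with $\Phi(t,x)\subseteq N^\epsilon(A)$ for all $t\ge T$ and all $x\in\mathcal{O}$, where $N^\epsilon(A)$ is the open $\epsilon$-neighborhood of $A$. "$X_n\to A$" means $\operatorname{dist}(X_n,A)\to0$. *)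

theory Defs
  imports "HOL-Analysis.Analysis" "HOL-Probability.Probability"
begin

definition abs_cont_on_interval :: "real \<Rightarrow> real \<Rightarrow> (real \<Rightarrow> 'a::real_normed_vector) \<Rightarrow> bool" where
  "abs_cont_on_interval a b f \<longleftrightarrow>
     (\<forall>\<epsilon>>0. \<exists>\<delta>>0. \<forall>(n::nat) (u::nat \<Rightarrow> real) (v::nat \<Rightarrow> real).
        (\<forall>i<n. a \<le> u i \<and> u i \<le> v i \<and> v i \<le> b) \<longrightarrow>
        (\<forall>i<n. \<forall>j<n. i \<noteq> j \<longrightarrow> v i \<le> u j \<or> v j \<le> u i) \<longrightarrow>
        (\<Sum>i<n. v i - u i) < \<delta> \<longrightarrow>
        (\<Sum>i<n. norm (f (v i) - f (u i))) < \<epsilon>)"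

definition abs_cont :: "(real \<Rightarrow> 'a::real_normed_vector) \<Rightarrow> bool" where
  "abs_cont f \<longleftrightarrow> (\<forall>a b. a \<le> b \<longrightarrow> abs_cont_on_interval a b f)"

definition DI_solution :: "('a::euclidean_space \<Rightarrow> 'a set) \<Rightarrow> 'a \<Rightarrow> (real \<Rightarrow> 'a) \<Rightarrow> bool" where
  "DI_solution F x0 x \<longleftrightarrow> abs_cont x \<and> x 0 = x0 \<and>
     (AE t in lborel. \<exists>v. (x has_vector_derivative v) (at t) \<and> v \<in> F (x t))"

definition DI_flow :: "('a::euclidean_space \<Rightarrow> 'a set) \<Rightarrow> real \<Rightarrow> 'a \<Rightarrow> 'a set" where
  "DI_flow F t x0 = {x t | x. DI_solution F x0 x}"

definition eps_nbhd :: "real \<Rightarrow> 'a::metric_space set \<Rightarrow> 'a set" where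
  "eps_nbhd \<epsilon> A = {y. \<exists>z\<in>A. dist y z < \<epsilon>}"

definition attracting_set :: "('a::euclidean_space \<Rightarrow> 'a set) \<Rightarrow> 'a set \<Rightarrow> 'a set \<Rightarrow> bool" where
  "attracting_set F A U \<longleftrightarrow> compact A \<and> open U \<and> A \<subseteq> U \<and>
     (\<forall>\<epsilon>>0. \<exists>T>0. \<forall>t\<ge>T. \<forall>x\<in>U. DI_flow F t x \<subseteq> eps_nbhd \<epsilon> A)"

text \<open>Natural filtration F_n = sigma(X_m, M_m, m \<le> n) (M is indexed from 1).\<close>
definition nat_filtr :: "'b measure \<Rightarrow> (nat \<Rightarrow> 'b \<Rightarrow> 'a::topological_space) \<Rightarrow> (nat \<Rightarrow> 'b \<Rightarrow> 'a) \<Rightarrow> nat \<Rightarrow> 'b measure" where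
  "nat_filtr P X M n = sigma (space P)
     ({X m -` B \<inter> space P | m B. m \<le> n \<and> B \<in> sets borel} \<union>
      {M m -` B \<inter> space P | m B. 1 \<le> m \<and> m \<le> n \<and> B \<in> sets borel})"

definition mart_diff :: "'b measure \<Rightarrow> (nat \<Rightarrow> 'b \<Rightarrow> 'a::euclidean_space) \<Rightarrow> (nat \<Rightarrow> 'b \<Rightarrow> 'a) \<Rightarrow> bool" where
  "mart_diff P X M \<longleftrightarrow> (\<forall>n. \<forall>e\<in>Basis.
      integrable P (\<lambda>\<omega>. M (Suc n) \<omega> \<bullet> e) \<and>
      (AE \<omega> in P. real_cond_exp P (nat_filtr P X M n) (\<lambda>\<omega>. M (Suc n) \<omega> \<bullet> e) \<omega> = 0))"

end

theory Submission
  imports Defs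
begin

text \<open>
  Noise is only counted while the iterate lies in a ball of radius \<open>R\<close>. The accumulated truncated noise
  \<open>\<zeta>\<close> is a martingale with increments bounded by a multiple of \<open>a k\<close>, so a single maximal Azuma inequality
  from time \<open>n0\<close> on keeps its oscillation below a fixed \<open>\<delta>\<close> outside an event of conditional probability
  at most \<open>2 d exp (- K' / b n0)\<close>; the same inequality started at late times makes \<open>\<zeta>\<close> almost surely Cauchy.

  Everything else is deterministic. A compactness argument (limits of perturbed Euler schemes solve the
  inclusion) yields \<open>T\<close> and \<open>\<delta>\<close> such that every scheme started in \<open>U'\<close> with steps and noise below \<open>\<delta>\<close> is
  back in \<open>U'\<close> during the time window \<open>[T, T + 1]\<close>, and by Gronwall it stays in the ball of radius \<open>R\<close>
  meanwhile. Iterating, the scheme never leaves that ball and visits \<open>U'\<close> at bounded time gaps. As the noise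
  dies out, the same tracking statement with smaller and smaller neighbourhoods of \<open>A\<close> gives convergence.

  A limit of Euler schemes is only known to be locally Lipschitz, and a solution needs a derivative almost
  everywhere; this is obtained in one dimension from the Vitali covering theorem.
\<close>

section \<open>Almost everywhere differentiability of Lipschitz curves\<close>

text \<open>The truncation answers the growth in (A3): the bound on \<open>M\<close> grows with
  \<open>X\<close>, which has no a priori bound, so only noise seen inside a ball has bounded
  increments. The radius comes from the tracking argument, before any probability enters.
  Controlling the noise over the whole future of \<open>n0\<close> at once, and not window by
  window, costs a single exponential tail, which gives the stated form of the bound; every later
  window inherits the control up to a factor 2.

  The interpolated schemes are step functions, so Arzela-Ascoli does not apply to them directly.
  Limits are taken pointwise, in a product of balls over all real times, which is compact but not
  sequentially compact; hence limits along filters instead of subsequences.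

  The flow is defined by solutions on the whole real line, so a limit curve on the half-line must
  also be continued to negative time. Reversing time turns \<open>F\<close> into \<open>- F\<close>,
  which satisfies the same hypotheses.\<close>

lemma interval_measures_sum_lborel:
  fixes f g :: "real \<Rightarrow> real"
  assumes f: "mono f" "continuous_on UNIV f" and g: "mono g" "continuous_on UNIV g"
    and fg: "\<And>x. f x + g x = x"
    and E: "E \<in> sets borel"
  shows "emeasure (interval_measure f) E + emeasure (interval_measure g) E = emeasure lborel E"
proof -
  let ?m = "\<lambda>E. emeasure (interval_measure f) E + emeasure (interval_measure g) E"
  define N where "N = measure_of UNIV (sets borel) ?m"
  have sets_N: "sets N = sets borel"
    unfolding N_def using sets.sigma_sets_eq[of borel] by (auto simp: space_borel)
  have "countably_additive (sets borel) ?m"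
    unfolding countably_additive_def
    by (auto simp flip: suminf_add intro!: arg_cong2[where f="(+)"] suminf_emeasure)
  moreover have "positive (sets borel) ?m"
    by (auto simp: positive_def)
  moreover have "sigma_algebra UNIV (sets (borel :: real measure))"
    using sets.sigma_algebra_axioms[of borel] by (simp add: space_borel)
  ultimately have em_N: "emeasure N B = ?m B" if "B \<in> sets borel" for B
    unfolding N_def by (intro emeasure_measure_of_sigma that)
  have cr: "continuous (at_right x) f" "continuous (at_right x) g" for x
    using f(2) g(2) by (auto simp: continuous_on_eq_continuous_at continuous_at_imp_continuous_within)
  \<comment> \<open>Half-open intervals generate the Borel sets, and on them the increments of
    \<open>f\<close> and \<open>g\<close> add up to \<open>b - a\<close>.\<close>
  have Ioc: "emeasure N {a<..b} = emeasure lborel {a<..b}" for a b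
  proof (cases "a \<le> b")
    case True
    have "f a \<le> f b" "g a \<le> g b" using True f g by (auto simp: mono_def)
    then show ?thesis
      using True f(1) g(1) fg[of a] fg[of b]
      by (simp add: em_N emeasure_interval_measure_Ioc monoD cr flip: ennreal_plus)
  qed (simp add: em_N)
  have "N = lborel"
  proof (rule measure_eqI_generator_eq[where \<Omega>=UNIV])
    show "emeasure N X = emeasure lborel X" if "X \<in> range (\<lambda>(a, b). {a<..b::real})" for X
      using that Ioc by auto
    show "(\<Union>i. {- real (i::nat)<..real i}) = UNIV"
      by (rule UN_Ioc_eq_UNIV)
  qed (auto simp: Ioc sets_N borel_sigma_sets_Ioc Int_stable_def)
  then show ?thesis
    using em_N[OF E] by simp
qed

text \<open>Vitali's theorem selects disjoint short intervals of slope at least \<open>q\<close>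
  that cover \<open>E\<close> up to a null set inside an open set slightly larger than
  \<open>E\<close>. Summing over them bounds \<open>q\<close> times the measure of \<open>E\<close>;
  the excess set is harmless because, \<open>g\<close> being monotone too, the measure of
  \<open>f\<close> is dominated by Lebesgue measure.\<close>

lemma emeasure_interval_measure_ge:
  fixes f g :: "real \<Rightarrow> real"
  assumes f: "mono f" "continuous_on UNIV f" and g: "mono g" "continuous_on UNIV g"
    and fg: "\<And>x. f x + g x = x"
    and E: "E \<in> sets borel"
    and q: "0 \<le> q"
    and dini: "\<And>t d. t \<in> E \<Longrightarrow> 0 < d \<Longrightarrow>
        \<exists>u v. u < v \<and> u \<le> t \<and> t \<le> v \<and> v - u < d \<and> q * (v - u) \<le> f v - f u"
  shows "ennreal q * emeasure lborel E \<le> emeasure (interval_measure f) E"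
proof (rule ennreal_le_epsilon)
  fix \<epsilon> :: real assume "0 < \<epsilon>"
  obtain O' where O': "open O'" "E \<subseteq> O'" "emeasure lborel (O' - E) < \<epsilon>"
    using outer_regular_lborel[OF E \<open>0 < \<epsilon>\<close>] by blast
  let ?\<nu> = "interval_measure f"
  define K where "K = {(u,v). u < v \<and> {u..v} \<subseteq> O' \<and> q * (v - u) \<le> f v - f u}"
  \<comment> \<open>The covering theorem speaks of balls, so an interval is coded by its midpoint
    and half its length.\<close>
  let ?c = "\<lambda>(u,v). (u+v)/2 :: real" and ?r = "\<lambda>(u,v). (v-u)/2 :: real"
  have cb: "cball (?c i) (?r i) = {fst i..snd i}" for i
    by (cases i) (auto simp: cball_eq_atLeastAtMost field_simps)
  obtain C where C: "countable C" "C \<subseteq> K"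
     "pairwise (\<lambda>i j. disjnt (cball (?c i) (?r i)) (cball (?c j) (?r j))) C"
     "negligible (E - (\<Union>i \<in> C. cball (?c i) (?r i)))"
  proof (rule Vitali_covering_theorem_cballs[of K ?r E ?c])
    show "0 < ?r i" if "i \<in> K" for i using that by (auto simp: K_def)
    fix t d :: real assume t: "t \<in> E" and d: "0 < d"
    obtain e where e: "e > 0" "ball t e \<subseteq> O'"
      using O' t by (meson open_contains_ball subsetD)
    obtain u v where uv: "u < v" "u \<le> t" "t \<le> v" "v - u < min d e" "q * (v - u) \<le> f v - f u"
      using dini[OF t, of "min d e"] d e by auto
    have "{u..v} \<subseteq> ball t e" using uv by (auto simp: dist_real_def)
    then have "(u,v) \<in> K" using uv e by (auto simp: K_def)
    moreover have "t \<in> cball (?c (u,v)) (?r (u,v))" unfolding cb using uv by simp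
    ultimately show "\<exists>i. i \<in> K \<and> t \<in> cball (?c i) (?r i) \<and> ?r i < d"
      using uv by (intro exI[of _ "(u,v)"]) auto
  qed
  define V where "V = (\<Union>i\<in>C. {fst i..snd i})"
  have V[measurable]: "V \<in> sets borel" unfolding V_def using C(1) by (intro sets.countable_UN') auto
  have disj: "disjoint_family_on (\<lambda>i. {fst i..snd i}) C"
    using C(3) unfolding cb by (auto simp: disjoint_family_on_def pairwise_def disjnt_def)
  have VO: "V \<subseteq> O'" using C(2) unfolding V_def K_def by fastforce
  have [measurable]: "E \<in> sets borel" "O' \<in> sets borel" using E O' by auto
  have "negligible (E - V)" using C(4) unfolding cb V_def .
  then have "E - V \<in> null_sets lborel"
    by (simp add: negligible_iff_null_sets null_sets_completion_iff)
  then have "emeasure lborel (E - V) = 0" by (simp add: null_sets_def)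
  then have "emeasure lborel E \<le> emeasure lborel V"
    using emeasure_mono[of E "(E - V) \<union> V" lborel] emeasure_subadditive[of "E - V" lborel V]
    by auto
  then have "ennreal q * emeasure lborel E \<le> ennreal q * emeasure lborel V"
    by (rule mult_left_mono) simp
  also have "\<dots> = (\<integral>\<^sup>+i. ennreal q * emeasure lborel {fst i..snd i} \<partial>count_space C)"
    unfolding V_def using C(1) disj by (simp add: emeasure_UN_countable nn_integral_cmult)
  also have "\<dots> \<le> (\<integral>\<^sup>+i. emeasure ?\<nu> {fst i..snd i} \<partial>count_space C)"
  proof (rule nn_integral_mono)
    fix i assume "i \<in> space (count_space C)"
    then have i: "fst i < snd i" "q * (snd i - fst i) \<le> f (snd i) - f (fst i)"
      using C(2) by (auto simp: K_def)
    then show "ennreal q * emeasure lborel {fst i..snd i} \<le> emeasure ?\<nu> {fst i..snd i}"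
      using f q by (subst emeasure_interval_measure_Icc) (auto simp: mono_def intro!: ennreal_leI simp flip: ennreal_mult)
  qed
  also have "\<dots> = emeasure ?\<nu> V"
    unfolding V_def using C(1) disj by (simp add: emeasure_UN_countable)
  also have "\<dots> \<le> emeasure ?\<nu> (E \<union> (O' - E))"
    using VO by (intro emeasure_mono) auto
  also have "\<dots> \<le> emeasure ?\<nu> E + emeasure ?\<nu> (O' - E)"
    by (intro emeasure_subadditive) auto
  also have "emeasure ?\<nu> (O' - E) \<le> emeasure lborel (O' - E)"
    using interval_measures_sum_lborel[OF f g fg, of "O' - E"] by (metis le_iff_add \<open>E \<in> sets borel\<close> \<open>O' \<in> sets borel\<close> sets.Diff)
  also have "\<dots> \<le> \<epsilon>" using O' by simp
  finally show "ennreal q * emeasure lborel E \<le> emeasure ?\<nu> E + ennreal \<epsilon>"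
    by (simp add: add_left_mono)
qed

text \<open>For a fixed nonzero \<open>h\<close> the condition on \<open>t\<close> is open, and
  countably many bounds on the size of \<open>h\<close> suffice, so the set is a countable
  intersection of open sets.\<close>

lemma frequently_quotient_borel:
  fixes f :: "real \<Rightarrow> real"
  assumes f: "continuous_on UNIV f"
  shows "{t. \<exists>\<^sub>F h in at 0. q < (f (t + h) - f t) / h} \<in> sets borel"
proof -
  have "{t. \<exists>\<^sub>F h in at 0. q < (f (t + h) - f t) / h} =
        (\<Inter>n. \<Union>h\<in>{h. h \<noteq> 0 \<and> \<bar>h\<bar> < inverse (real (Suc n))}. {t. q < (f (t + h) - f t) / h})"
    (is "?L = ?R")
  proof (intro subset_antisym subsetI)
    fix t assume "t \<in> ?L"
    then show "t \<in> ?R"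
      by (auto simp: frequently_at dist_real_def Bex_def)
  next
    fix t assume t: "t \<in> ?R"
    have "\<exists>h\<in>UNIV. h \<noteq> 0 \<and> dist h 0 < d \<and> q < (f (t + h) - f t) / h" if d: "d > 0" for d
    proof -
      obtain n where "inverse (real (Suc n)) < d" using reals_Archimedean[OF d] by auto
      moreover have "t \<in> (\<Union>h\<in>{h. h \<noteq> 0 \<and> \<bar>h\<bar> < inverse (real (Suc n))}. {t. q < (f (t + h) - f t) / h})"
        using t by (rule INT_D) simp
      ultimately show ?thesis by (force simp: dist_real_def)
    qed
    then show "t \<in> ?L" by (simp add: frequently_at)
  qed
  moreover have "open {t. q < (f (t + h) - f t) / h}" if "h \<noteq> 0" for h
    by (intro open_Collect_less continuous_intros continuous_on_divide)
       (use that in \<open>auto intro!: continuous_on_compose2[OF f] continuous_intros f\<close>)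
  then have "(\<Union>h\<in>{h. h \<noteq> 0 \<and> \<bar>h\<bar> < inverse (real (Suc n))}. {t. q < (f (t + h) - f t) / h}) \<in> sets borel" for n
    by (intro borel_open open_UN) auto
  ultimately show ?thesis by (auto intro!: sets.countable_INT')
qed

lemma frequently_quotient_interval:
  fixes f :: "real \<Rightarrow> real"
  assumes "\<exists>\<^sub>F h in at 0. q < (f (t + h) - f t) / h" and "0 < d"
  shows "\<exists>u v. u < v \<and> u \<le> t \<and> t \<le> v \<and> v - u < d \<and> q * (v - u) \<le> f v - f u"
proof -
  obtain h where h: "h \<noteq> 0" "\<bar>h\<bar> < d" "q < (f (t + h) - f t) / h"
    using assms by (auto simp: frequently_at dist_real_def)
  show ?thesis
  proof (cases "h > 0")
    case True
    then show ?thesis using h by (intro exI[of _ t] exI[of _ "t+h"]) (auto simp: field_simps)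
  next
    case False
    then show ?thesis using h by (intro exI[of _ "t+h"] exI[of _ t]) (auto simp: field_simps)
  qed
qed

text \<open>As \<open>f\<close> is 1-Lipschitz, \<open>(t + f t) / 2\<close> and
  \<open>(t - f t) / 2\<close> are monotone, and they add up to the identity. On the exceptional set
  they have slopes at least \<open>(1 + q) / 2\<close> and \<open>(1 - p) / 2\<close> over
  arbitrarily short intervals, so their measures together give it at least
  \<open>1 + (q - p) / 2\<close> times its Lebesgue measure. But the two measures sum to Lebesgue
  measure.\<close>

lemma dini_gap_null:
  fixes f :: "real \<Rightarrow> real"
  assumes lip: "1-lipschitz_on UNIV f" and pq: "p < q"
  shows "AE t in lborel. \<not> ((\<exists>\<^sub>F h in at 0. (f (t + h) - f t) / h < p) \<and>
                            (\<exists>\<^sub>F h in at 0. q < (f (t + h) - f t) / h))"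
proof -
  have f: "continuous_on UNIV f" using lip by (rule lipschitz_on_continuous_on)
  have L: "\<bar>f x - f y\<bar> \<le> \<bar>x - y\<bar>" for x y
    using lipschitz_onD[OF lip, of x y] by (simp add: dist_real_def)
  define g1 where "g1 = (\<lambda>t. (t + f t) / 2)"
  define g2 where "g2 = (\<lambda>t. (t - f t) / 2)"
  have g: "mono g1" "continuous_on UNIV g1" "mono g2" "continuous_on UNIV g2"
    unfolding mono_def g1_def g2_def using L
    by (auto intro!: continuous_intros f) (smt (verit) L)+
  have sum1: "g1 x + g2 x = x" "g2 x + g1 x = x" for x by (auto simp: g1_def g2_def field_simps)
  \<comment> \<open>The condition with \<open>p\<close> is turned into a lower bound for the
    quotients of \<open>- f\<close>, so that the preceding lemmas serve both halves.\<close>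
  define E0 where "E0 = {t. (\<exists>\<^sub>F h in at 0. -p < (-f (t + h) - - f t) / h) \<and> (\<exists>\<^sub>F h in at 0. q < (f (t + h) - f t) / h)}"
  have E0: "E0 \<in> sets borel"
  proof -
    have "continuous_on UNIV (\<lambda>t. - f t)" using f by (rule continuous_on_minus)
    from sets.Int[OF frequently_quotient_borel[OF this] frequently_quotient_borel[OF f]]
    show ?thesis by (simp add: E0_def Collect_conj_eq)
  qed
  \<comment> \<open>On a bounded piece the measure is finite and can be cancelled.\<close>
  have null: "emeasure lborel (E0 \<inter> {-real n..real n}) = 0" for n
  proof -
    let ?E = "E0 \<inter> {-real n..real n}"
    have E[measurable]: "?E \<in> sets borel" using E0 by auto
    show ?thesis
    proof (cases "?E = {}")
      case False
      then obtain t where t: "t \<in> ?E" by blast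
      \<comment> \<open>The quotients lie between -1 and 1, so one point of the set forces
        \<open>q \<le> 1\<close> and \<open>-1 \<le> p\<close>; this makes both slope bounds
        nonnegative.\<close>
      have fr1: "\<exists>h. q < (f (t + h) - f t) / h \<and> h \<noteq> 0" and fr2: "\<exists>h. -p < (-f (t + h) - - f t) / h \<and> h \<noteq> 0"
        using t by (auto simp: E0_def frequently_at intro: zero_less_one)
      have Q: "\<bar>(f (t + h) - f t) / h\<bar> \<le> 1" if "h \<noteq> 0" for h
        using L[of "t+h" t] that by (simp add: abs_divide field_simps)
      have "q \<le> 1" using fr1 Q by (smt (verit))
      have "- 1 \<le> p"
      proof -
        obtain h where "-p < (-f (t + h) - - f t) / h" "h \<noteq> 0" using fr2 by auto
        moreover have "(-f (t + h) - - f t) / h = - ((f (t + h) - f t) / h)" by (simp add: diff_divide_distrib)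
        ultimately show ?thesis using Q[of h] by linarith
      qed
      have i1: "ennreal ((1 + q)/2) * emeasure lborel ?E \<le> emeasure (interval_measure g1) ?E"
      proof (rule emeasure_interval_measure_ge[OF g sum1(1) E])
        show "0 \<le> (1 + q) / 2" using \<open>-1 \<le> p\<close> pq by simp
        fix t d :: real assume "t \<in> ?E" "0 < d"
        then obtain u v where "u < v \<and> u \<le> t \<and> t \<le> v \<and> v - u < d \<and> q * (v - u) \<le> f v - f u"
          using frequently_quotient_interval[of q f t d] by (auto simp: E0_def)
        then show "\<exists>u v. u < v \<and> u \<le> t \<and> t \<le> v \<and> v - u < d \<and> (1 + q) / 2 * (v - u) \<le> g1 v - g1 u"
          by (intro exI[of _ u] exI[of _ v]) (auto simp: g1_def field_simps)
      qed
      have i2: "ennreal ((1 - p)/2) * emeasure lborel ?E \<le> emeasure (interval_measure g2) ?E"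
      proof (rule emeasure_interval_measure_ge[OF g(3,4,1,2) sum1(2) E])
        show "0 \<le> (1 - p) / 2" using \<open>q \<le> 1\<close> pq by simp
        fix t d :: real assume "t \<in> ?E" "0 < d"
        then obtain u v where "u < v \<and> u \<le> t \<and> t \<le> v \<and> v - u < d \<and> -p * (v - u) \<le> - f v - - f u"
          using frequently_quotient_interval[of "-p" "\<lambda>x. - f x" t d] by (auto simp: E0_def)
        then show "\<exists>u v. u < v \<and> u \<le> t \<and> t \<le> v \<and> v - u < d \<and> (1 - p) / 2 * (v - u) \<le> g2 v - g2 u"
          by (intro exI[of _ u] exI[of _ v]) (auto simp: g2_def field_simps)
      qed
      have fin: "emeasure lborel ?E < \<infinity>"
        by (rule le_less_trans[OF emeasure_mono[of _ "{-real n..real n}"]]) auto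
      then obtain r where r: "0 \<le> r" "emeasure lborel ?E = ennreal r"
        by (metis ennreal_cases infinity_ennreal_def less_irrefl)
      have "ennreal ((1 + q)/2) * emeasure lborel ?E + ennreal ((1 - p)/2) * emeasure lborel ?E \<le> emeasure lborel ?E"
        using add_mono[OF i1 i2] interval_measures_sum_lborel[OF g sum1(1) E] by simp
      then have "ennreal ((1 + q)/2 * r + (1 - p)/2 * r) \<le> ennreal r"
        using r \<open>q \<le> 1\<close> \<open>-1 \<le> p\<close> pq by (simp add: ennreal_plus flip: ennreal_mult)
      then have "(1 + q)/2 * r + (1 - p)/2 * r \<le> r"
        using r(1) by (simp add: ennreal_le_iff)
      then have "(q - p) * r \<le> 0" by (simp add: field_simps)
      then have "r = 0" using pq r(1) by (smt (verit) mult_pos_pos)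
      then show ?thesis using r by simp
    qed simp
  qed
  have "AE t in lborel. \<forall>n. t \<notin> E0 \<inter> {-real n..real n}"
    unfolding AE_all_countable using E0 null by (intro allI AE_not_in) (auto simp: null_sets_def)
  then show ?thesis
  proof eventually_elim
    case (elim t)
    obtain n where "\<bar>t\<bar> \<le> real n" using real_arch_simple by blast
    then have "t \<in> {-real n..real n}" by auto
    then have "t \<notin> E0" using elim by blast
    moreover have "(- f (t + h) - - f t) / h = - ((f (t + h) - f t) / h)" for h by (simp add: diff_divide_distrib)
    ultimately show ?case by (auto simp: E0_def)
  qed
qed

text \<open>\<open>Sup S\<close> is the upper limit of \<open>Q\<close>. A smaller lower limit would
  leave room for rationals \<open>p < q\<close> between them, which \<open>gap\<close> forbids;
  rationals keep the number of exceptional null sets countable.\<close>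

lemma bounded_real_limit_exists:
  fixes Q :: "real \<Rightarrow> real"
  assumes bd: "eventually (\<lambda>h. \<bar>Q h\<bar> \<le> B) F" and F: "F \<noteq> bot"
    and gap: "\<And>p q. p \<in> \<rat> \<Longrightarrow> q \<in> \<rat> \<Longrightarrow> p < q \<Longrightarrow> \<not> ((\<exists>\<^sub>F h in F. Q h < p) \<and> (\<exists>\<^sub>F h in F. q < Q h))"
  shows "\<exists>l. (Q \<longlongrightarrow> l) F"
proof -
  define S where "S = {q. \<exists>\<^sub>F h in F. q < Q h}"
  have "\<forall>\<^sub>F h in F. -B - 1 < Q h" using bd by eventually_elim auto
  then have ne: "-B - 1 \<in> S" unfolding S_def using F by (simp add: eventually_frequently)
  have ub: "q \<le> B" if "q \<in> S" for q
  proof (rule ccontr)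
    assume "\<not> q \<le> B"
    then have "\<forall>\<^sub>F h in F. \<not> q < Q h" using bd by (auto elim!: eventually_mono)
    then show False using that by (simp add: S_def frequently_def)
  qed
  then have bdd: "bdd_above S" by (auto simp: bdd_above_def)
  have "(Q \<longlongrightarrow> Sup S) F"
  proof (rule tendstoI)
    fix e :: real assume e: "0 < e"
    have "Sup S + e/2 \<notin> S" using cSup_upper[OF _ bdd, of "Sup S + e/2"] e by auto
    then have 1: "\<forall>\<^sub>F h in F. Q h \<le> Sup S + e/2" by (simp add: S_def frequently_def not_less)
    have "Sup S - e/2 < Sup S" using e by simp
    then obtain s where s: "s \<in> S" "Sup S - e/2 < s" using less_cSup_iff[OF _ bdd] ne by blast
    obtain q where q: "q \<in> \<rat>" "Sup S - e/2 < q" "q < s" using Rats_dense_in_real[OF s(2)] by auto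
    obtain p where p: "p \<in> \<rat>" "Sup S - e/2 < p" "p < q" using Rats_dense_in_real[OF q(2)] by auto
    have "\<exists>\<^sub>F h in F. q < Q h" using s(1) unfolding S_def
      using q(3) by (auto elim!: frequently_elim1)
    then have "\<not> (\<exists>\<^sub>F h in F. Q h < p)" using gap p q by blast
    then have "\<forall>\<^sub>F h in F. p \<le> Q h" by (simp add: frequently_def not_less)
    with 1 show "\<forall>\<^sub>F h in F. dist (Q h) (Sup S) < e"
      by eventually_elim (use p e in \<open>auto simp: dist_real_def\<close>)
  qed
  then show ?thesis by blast
qed

lemma lipschitz_real_AE_differentiable:
  fixes f :: "real \<Rightarrow> real"
  assumes lip: "L-lipschitz_on UNIV f"
  shows "AE t in lborel. \<exists>d. (f has_real_derivative d) (at t)"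
proof -
  have "0 \<le> L" using lip by (rule lipschitz_on_nonneg)
  \<comment> \<open>Rescales to Lipschitz constant 1; the added 1 covers
    \<open>L = 0\<close>.\<close>
  define c where "c = 1 / (L + 1)"
  define g where "g = (\<lambda>t. c * f t)"
  have c: "0 < c" "c * L \<le> 1" using \<open>0 \<le> L\<close> by (auto simp: c_def field_simps)
  have g: "1-lipschitz_on UNIV g"
  proof (rule lipschitz_onI)
    fix x y :: real
    have "dist (g x) (g y) = c * dist (f x) (f y)"
      using c by (simp add: g_def dist_real_def abs_mult flip: right_diff_distrib)
    also have "\<dots> \<le> c * (L * dist x y)" using c lipschitz_onD[OF lip, of x y] by (intro mult_left_mono) auto
    also have "\<dots> = (c * L) * dist x y" by simp
    also have "\<dots> \<le> 1 * dist x y" using c by (intro mult_right_mono) auto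
    finally show "dist (g x) (g y) \<le> 1 * dist x y" .
  qed simp
  have L: "\<bar>g x - g y\<bar> \<le> \<bar>x - y\<bar>" for x y
    using lipschitz_onD[OF g, of x y] by (simp add: dist_real_def)
  have "AE t in lborel. \<forall>p\<in>\<rat>. \<forall>q\<in>\<rat>. p < q \<longrightarrow> \<not> ((\<exists>\<^sub>F h in at 0. (g (t + h) - g t) / h < p) \<and>
                            (\<exists>\<^sub>F h in at 0. q < (g (t + h) - g t) / h))"
    using dini_gap_null[OF g] by (intro AE_ball_countable' countable_rat) auto
  then show ?thesis
  proof eventually_elim
    case (elim t)
    have "\<exists>l. ((\<lambda>h. (g (t + h) - g t) / h) \<longlongrightarrow> l) (at 0)"
    proof (rule bounded_real_limit_exists)
      show "\<forall>\<^sub>F h in at 0. \<bar>(g (t + h) - g t) / h\<bar> \<le> 1"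
      proof (intro always_eventually allI)
        fix h show "\<bar>(g (t + h) - g t) / h\<bar> \<le> 1"
          using L[of "t+h" t] by (cases "h = 0") (auto simp: abs_divide field_simps)
      qed
    qed (use elim in auto)
    then obtain l where "(g has_real_derivative l) (at t)" by (auto simp: DERIV_def)
    then have "((\<lambda>x. (1/c) * g x) has_real_derivative (1/c) * l) (at t)" by (intro DERIV_cmult)
    moreover have "(\<lambda>x. (1/c) * g x) = f" using c by (auto simp: g_def)
    ultimately show ?case by auto
  qed
qed

lemma lipschitz_AE_vector_derivative:
  fixes f :: "real \<Rightarrow> 'a::euclidean_space"
  assumes lip: "L-lipschitz_on UNIV f"
  shows "AE t in lborel. \<exists>d. (f has_vector_derivative d) (at t)"
proof -
  have "AE t in lborel. \<forall>b\<in>Basis. \<exists>d. ((\<lambda>t. f t \<bullet> b) has_real_derivative d) (at t)"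
  proof (intro AE_finite_allI finite_Basis lipschitz_real_AE_differentiable)
    fix b :: 'a assume b: "b \<in> Basis"
    show "L-lipschitz_on UNIV (\<lambda>t. f t \<bullet> b)"
    proof (rule lipschitz_onI)
      fix x y :: real
      have "dist (f x \<bullet> b) (f y \<bullet> b) \<le> dist (f x) (f y)"
        using Basis_le_norm[OF b, of "f x - f y"] by (simp add: dist_norm inner_diff_left)
      then show "dist (f x \<bullet> b) (f y \<bullet> b) \<le> L * dist x y"
        using lipschitz_onD[OF lip, of x y] by simp
    qed (use lip lipschitz_on_nonneg in blast)
  qed
  then show ?thesis
  proof eventually_elim
    case (elim t)
    then obtain d where d: "\<And>b. b \<in> Basis \<Longrightarrow> ((\<lambda>t. f t \<bullet> b) has_real_derivative d b) (at t)" by metis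
    have "(f has_vector_derivative (\<Sum>b\<in>Basis. d b *\<^sub>R b)) (at t)"
      unfolding has_vector_derivative_def
    proof (subst has_derivative_componentwise_within, intro ballI)
      fix b :: 'a assume b: "b \<in> Basis"
      have "(\<lambda>x. (x *\<^sub>R (\<Sum>b\<in>Basis. d b *\<^sub>R b)) \<bullet> b) = (\<lambda>x. d b * x)"
        using b by (auto simp: inner_sum_left_Basis)
      then show "((\<lambda>x. f x \<bullet> b) has_derivative (\<lambda>x. (x *\<^sub>R (\<Sum>b\<in>Basis. d b *\<^sub>R b)) \<bullet> b)) (at t)"
        using d[OF b] by (simp add: has_field_derivative_def)
    qed
    then show ?case by blast
  qed
qed

text \<open>Clamping the argument to \<open>[-n, n]\<close> gives globally Lipschitz curves, each
  equal to \<open>f\<close> near every point of the open interval.\<close>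

lemma locally_lipschitz_AE_vector_derivative:
  fixes f :: "real \<Rightarrow> 'a::euclidean_space"
  assumes lip: "\<And>n::nat. \<exists>L. L-lipschitz_on {-real n..real n} f"
  shows "AE t in lborel. \<exists>d. (f has_vector_derivative d) (at t)"
proof -
  define cl where "cl = (\<lambda>n::nat. \<lambda>t::real. max (-real n) (min (real n) t))"
  have "AE t in lborel. \<exists>d. ((\<lambda>t. f (cl n t)) has_vector_derivative d) (at t)" for n
  proof -
    obtain L where L: "L-lipschitz_on {-real n..real n} f" using lip by blast
    have "L-lipschitz_on UNIV (\<lambda>t. f (cl n t))"
    proof (rule lipschitz_onI)
      fix x y :: real
      have "dist (f (cl n x)) (f (cl n y)) \<le> L * dist (cl n x) (cl n y)"
        by (rule lipschitz_onD[OF L]) (auto simp: cl_def)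
      also have "\<dots> \<le> L * dist x y"
        using lipschitz_on_nonneg[OF L] by (intro mult_left_mono) (auto simp: cl_def dist_real_def)
      finally show "dist (f (cl n x)) (f (cl n y)) \<le> L * dist x y" .
    qed (use L lipschitz_on_nonneg in blast)
    then show ?thesis by (rule lipschitz_AE_vector_derivative)
  qed
  then have "AE t in lborel. \<forall>n. \<exists>d. ((\<lambda>t. f (cl n t)) has_vector_derivative d) (at t)"
    by (simp add: AE_all_countable)
  then show ?thesis
  proof eventually_elim
    case (elim t)
    obtain n where n: "\<bar>t\<bar> < real n" using reals_Archimedean2 by blast
    obtain d where "((\<lambda>t. f (cl n t)) has_vector_derivative d) (at t)" using elim by blast
    then have "(f has_vector_derivative d) (at t)"
      by (rule has_vector_derivative_transform_within_open[where S="{-real n<..<real n}"])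
         (use n in \<open>auto simp: cl_def\<close>)
    then show ?case by blast
  qed
qed

section \<open>Differential inclusions as limits of Euler schemes\<close>

text \<open>\<open>G\<close> plays the part of a subsequence: it joins the tails of the sequence
  with the preimages of the neighbourhoods of a cluster point \<open>p\<close>.\<close>

lemma compact_cluster_filter:
  fixes f :: "nat \<Rightarrow> 'b::topological_space"
  assumes S: "compact S" and f: "\<And>n. f n \<in> S"
  obtains p G where "p \<in> S" "G \<noteq> bot" "G \<le> sequentially" "(f \<longlongrightarrow> p) G"
proof -
  have "filtermap f sequentially \<le> principal S" "filtermap f sequentially \<noteq> bot"
    using f by (auto simp: le_principal eventually_filtermap filtermap_bot_iff)
  then obtain p where p: "p \<in> S" "inf (nhds p) (filtermap f sequentially) \<noteq> bot"
    using S[unfolded compact_filter, rule_format, of "filtermap f sequentially"]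
    by (auto simp: le_principal)
  define G where "G = inf sequentially (filtercomap f (nhds p))"
  have "G \<noteq> bot"
  proof
    assume "G = bot"
    then obtain P Q where PQ: "eventually P sequentially" "eventually Q (filtercomap f (nhds p))" "\<And>n. P n \<Longrightarrow> Q n \<Longrightarrow> False"
      unfolding G_def trivial_limit_def eventually_inf by blast
    then obtain R where R: "eventually R (nhds p)" "\<And>n. R (f n) \<Longrightarrow> Q n"
      unfolding eventually_filtercomap by blast
    have "eventually (\<lambda>x. \<not> R x) (filtermap f sequentially)"
      unfolding eventually_filtermap using PQ(1) by eventually_elim (use PQ(3) R(2) in blast)
    with R(1) have "eventually (\<lambda>x. False) (inf (nhds p) (filtermap f sequentially))"
      unfolding eventually_inf by blast
    with p(2) show False by (simp add: trivial_limit_def)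
  qed
  moreover have "(f \<longlongrightarrow> p) G"
    unfolding G_def by (rule filterlim_mono[OF filterlim_filtercomap order_refl]) simp
  ultimately show ?thesis using p(1) that[of p G] by (simp add: G_def)
qed

text \<open>Tychonoff's theorem, carried over to the topology of the function type.\<close>

lemma compact_PiE_UNIV:
  fixes S :: "'i \<Rightarrow> 'b::topological_space set"
  assumes "\<And>i. compact (S i)"
  shows "compact (PiE UNIV S)"
proof -
  have "compactin (product_topology (\<lambda>i. euclidean) UNIV) (PiE UNIV S)"
    unfolding compactin_PiE using assms by auto
  then show ?thesis
    unfolding euclidean_product_topology by simp
qed

section \<open>Set-valued maps of Marchaud type\<close>

locale marchaud =
  fixes F :: "'a::euclidean_space \<Rightarrow> 'a set" and K :: real
  assumes nonempty: "F x \<noteq> {}"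
    and convex: "convex (F x)"
    and compact: "compact (F x)"
    and K_pos: "0 < K"
    and growth: "v \<in> F x \<Longrightarrow> norm v \<le> K * (1 + norm x)"
    and closed_graph: "xs \<longlonglongrightarrow> x \<Longrightarrow> (\<And>n. vs n \<in> F (xs n)) \<Longrightarrow> vs \<longlonglongrightarrow> v \<Longrightarrow> v \<in> F x"
begin

lemma marchaud_uminus: "marchaud (\<lambda>x. uminus ` F x) K"
proof
  fix xs :: "nat \<Rightarrow> 'a" and x vs v
  assume *: "xs \<longlonglongrightarrow> x" "\<And>n. vs n \<in> uminus ` F (xs n)" "vs \<longlonglongrightarrow> v"
  have "- vs n \<in> F (xs n)" for n using *(2)[of n] by auto
  from closed_graph[OF *(1) this tendsto_minus[OF *(3)]] have "- v \<in> F x" .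
  then show "v \<in> uminus ` F x" by force
qed (use nonempty convex compact K_pos growth in \<open>auto simp: convex_negations compact_negations\<close>)

text \<open>Otherwise points tending to \<open>x\<close> carry velocities beyond \<open>c\<close> in
  direction \<open>e\<close>. Linear growth bounds these velocities, a subsequence converges, and
  the closed graph puts its limit into \<open>F x\<close>.\<close>

lemma support_upper_semicontinuous:
  assumes "\<And>v. v \<in> F x \<Longrightarrow> e \<bullet> v < c"
  obtains \<epsilon> where "0 < \<epsilon>" "\<And>w v. w \<in> ball x \<epsilon> \<Longrightarrow> v \<in> F w \<Longrightarrow> e \<bullet> v \<le> c"
proof (rule ccontr)
  assume "\<not> thesis"
  then have "\<exists>w v. w \<in> ball x (inverse (real (Suc n))) \<and> v \<in> F w \<and> e \<bullet> v > c" for n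
    using that[of "inverse (real (Suc n))"] by (force simp: not_le)
  then obtain w v where wv: "\<And>n. w n \<in> ball x (inverse (real (Suc n)))" "\<And>n. v n \<in> F (w n)" "\<And>n. e \<bullet> v n > c"
    by metis
  have wd: "dist (w n) x \<le> inverse (real (Suc n))" for n
    using wv(1)[of n] by (simp add: dist_commute)
  have w: "w \<longlonglongrightarrow> x"
  proof (rule metric_tendsto_imp_tendsto[OF LIMSEQ_inverse_real_of_nat])
    show "\<forall>\<^sub>F n in sequentially. dist (w n) x \<le> dist (inverse (real (Suc n))) 0"
      using wd by (intro always_eventually allI) (simp add: dist_real_def)
  qed
  have "norm (v n) \<le> K * (1 + (norm x + 1))" for n
  proof -
    have "norm (w n) \<le> norm x + dist (w n) x" using norm_triangle_sub[of "w n" x] by (simp add: dist_norm)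
    also have "dist (w n) x \<le> 1" using wd[of n] by (rule order_trans) (simp add: field_simps)
    finally have "K * (1 + norm (w n)) \<le> K * (1 + (norm x + 1))" using K_pos by simp
    with growth[OF wv(2)[of n]] show ?thesis by linarith
  qed
  then have "bounded (range v)" by (auto simp: bounded_iff)
  then obtain l r where r: "strict_mono r" "(v \<circ> r) \<longlonglongrightarrow> l"
    using bounded_imp_convergent_subsequence by blast
  have "l \<in> F x"
    by (rule closed_graph[OF LIMSEQ_subseq_LIMSEQ[OF w r(1)] _ r(2)]) (simp add: wv)
  moreover have "c \<le> e \<bullet> l"
    by (rule tendsto_lowerbound[OF tendsto_inner[OF tendsto_const r(2)]])
       (use wv(3) in \<open>auto intro!: always_eventually less_imp_le\<close>)
  ultimately show False using assms[of l] by simp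
qed

text \<open>The derivative condition is phrased through support functions because in this form it survives pointwise limits.\<close>

definition half_solution :: "(real \<Rightarrow> 'a) \<Rightarrow> bool" where
  "half_solution y \<longleftrightarrow>
     (\<forall>R\<ge>0. \<exists>L. L-lipschitz_on {0..R} y) \<and>
     (\<forall>s\<ge>0. \<forall>e c. (\<forall>v\<in>F (y s). e \<bullet> v < c) \<longrightarrow>
        (\<exists>d>0. \<forall>t. s < t \<and> t < s + d \<longrightarrow> e \<bullet> (y t - y s) \<le> c * (t - s)))"

lemma half_solution_lipschitz: "half_solution y \<Longrightarrow> 0 \<le> R \<Longrightarrow> \<exists>L. L-lipschitz_on {0..R} y"
  by (simp add: half_solution_def)

text \<open>A derivative outside the closed convex set \<open>F (y s)\<close> could be strictly
  separated from it, but increments of \<open>y\<close> to the right of \<open>s\<close> respect the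
  bound of the half-space that contains \<open>F (y s)\<close>. The signs of \<open>a\<close> and
  \<open>b\<close> are flipped because the definition bounds from above.\<close>

lemma half_solution_derivative:
  assumes y: "half_solution y" and s: "0 \<le> s" and v: "(y has_vector_derivative v) (at s)"
  shows "v \<in> F (y s)"
proof (rule ccontr)
  assume "v \<notin> F (y s)"
  then obtain a b where ab: "a \<bullet> v < b" "\<And>w. w \<in> F (y s) \<Longrightarrow> b < a \<bullet> w"
    using separating_hyperplane_closed_point[OF convex compact_imp_closed[OF compact]] by metis
  obtain d where d: "d > 0" "\<And>t. s < t \<and> t < s + d \<Longrightarrow> (- a) \<bullet> (y t - y s) \<le> (- b) * (t - s)"
    using y s ab(2) unfolding half_solution_def by (metis inner_minus_left neg_less_iff_less)
  have "((\<lambda>t. (- a) \<bullet> y t) has_vector_derivative (- a) \<bullet> v) (at s)"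
    by (rule bounded_linear.has_vector_derivative[OF bounded_linear_inner_right v])
  then have "((\<lambda>t. (- a) \<bullet> y t) has_real_derivative (- a) \<bullet> v) (at s within {s<..})"
    by (simp add: has_real_derivative_iff_has_vector_derivative has_vector_derivative_at_within)
  then have lim: "((\<lambda>t. ((- a) \<bullet> y t - (- a) \<bullet> y s) / (t - s)) \<longlongrightarrow> (- a) \<bullet> v) (at_right s)"
    by (simp add: has_field_derivative_iff)
  have "\<forall>\<^sub>F t in at_right s. s < t \<and> t < s + d"
    using d(1) by (auto simp: eventually_at_right_field intro!: exI[of _ "s + d"])
  then have "\<forall>\<^sub>F t in at_right s. ((- a) \<bullet> y t - (- a) \<bullet> y s) / (t - s) \<le> - b"
    by eventually_elim (use d(2) in \<open>auto simp: divide_le_eq inner_diff_right\<close>)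
  then have "(- a) \<bullet> v \<le> - b"
    by (rule tendsto_upperbound[OF lim]) simp
  with ab(1) show False by simp
qed


text \<open>A discrete Gronwall estimate. In the applications \<open>x\<close> is the scheme and
  \<open>z\<close> the scheme minus its noise, at distance at most 1. Velocities are then at most
  \<open>K * (2 + norm z)\<close>, so \<open>2 + norm z\<close> gains at most the factor
  \<open>1 + K * h\<close> per step.\<close>

lemma euler_growth:
  fixes z x :: "nat \<Rightarrow> 'a" and h :: "nat \<Rightarrow> real"
  assumes h: "\<And>k. k < N \<Longrightarrow> 0 \<le> h k"
    and z: "\<And>k. k < N \<Longrightarrow> \<exists>v\<in>F (x k). z (Suc k) = z k + h k *\<^sub>R v"
    and x: "\<And>k. k < N \<Longrightarrow> norm (x k) \<le> 1 + norm (z k)"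
    and k: "k \<le> N"
  shows "2 + norm (z k) \<le> exp (K * (\<Sum>i<k. h i)) * (2 + norm (z 0))"
  using k
proof (induction k)
  case (Suc k)
  then have k: "k < N" by simp
  obtain v where v: "v \<in> F (x k)" "z (Suc k) = z k + h k *\<^sub>R v" using z[OF k] by blast
  have "norm v \<le> K * (2 + norm (z k))"
    using growth[OF v(1)] mult_left_mono[OF x[OF k], of K] K_pos by (simp add: algebra_simps)
  then have "h k * norm v \<le> h k * (K * (2 + norm (z k)))" using h[OF k] by (intro mult_left_mono) auto
  moreover have "norm (z (Suc k)) \<le> norm (z k) + h k * norm v"
    unfolding v(2) using norm_triangle_ineq[of "z k" "h k *\<^sub>R v"] h[OF k] by simp
  ultimately have "2 + norm (z (Suc k)) \<le> (1 + K * h k) * (2 + norm (z k))"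
    by (simp add: algebra_simps)
  also have "\<dots> \<le> exp (K * h k) * (2 + norm (z k))"
    by (intro mult_right_mono exp_ge_add_one_self) (auto intro: add_nonneg_nonneg)
  also have "\<dots> \<le> exp (K * h k) * (exp (K * (\<Sum>i<k. h i)) * (2 + norm (z 0)))"
    using Suc by (intro mult_left_mono) auto
  also have "\<dots> = exp (K * (\<Sum>i<Suc k. h i)) * (2 + norm (z 0))"
    by (simp add: algebra_simps flip: exp_add)
  finally show ?case .
qed simp

text \<open>Up to elapsed time \<open>S\<close> the growth estimate bounds all velocities by one
  constant.\<close>

lemma euler_lipschitz:
  fixes z x :: "nat \<Rightarrow> 'a" and h :: "nat \<Rightarrow> real"
  assumes h: "\<And>k. 0 \<le> h k"
    and z: "\<And>k. \<exists>v\<in>F (x k). z (Suc k) = z k + h k *\<^sub>R v"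
    and x: "\<And>k. norm (x k) \<le> 1 + norm (z k)"
    and S: "(\<Sum>k<i. h k) \<le> S" "(\<Sum>k<j. h k) \<le> S" and B: "norm (z 0) \<le> B"
  shows "norm (z i - z j) \<le> K * (exp (K * S) * (2 + B)) * \<bar>(\<Sum>k<i. h k) - (\<Sum>k<j. h k)\<bar>"
proof -
  define L where "L = K * (exp (K * S) * (2 + B))"
  have main: "norm (z j - z i) \<le> L * ((\<Sum>k<j. h k) - (\<Sum>k<i. h k))"
    if "i \<le> j" "(\<Sum>k<j. h k) \<le> S" for i j
    using that
  proof (induction j rule: dec_induct)
    case (step k)
    have tk: "(\<Sum>k<k. h k) \<le> S" using step.prems h[of k] by simp
    obtain v where v: "v \<in> F (x k)" "z (Suc k) = z k + h k *\<^sub>R v" using z by blast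
    have "norm v \<le> K * (2 + norm (z k))"
      using growth[OF v(1)] mult_left_mono[OF x[of k], of K] K_pos by (simp add: algebra_simps)
    also have "2 + norm (z k) \<le> exp (K * (\<Sum>i<k. h i)) * (2 + norm (z 0))"
      by (rule euler_growth[where N=k and x=x, OF h z x order_refl])
    also have "\<dots> \<le> exp (K * S) * (2 + B)"
      using tk B K_pos by (intro mult_mono) auto
    finally have "norm v \<le> L" using K_pos by (simp add: L_def)
    have "norm (z (Suc k) - z i) \<le> norm (z k - z i) + norm (h k *\<^sub>R v)"
      using norm_triangle_ineq[of "z k - z i" "h k *\<^sub>R v"] by (simp add: v(2) algebra_simps)
    also have "\<dots> \<le> L * ((\<Sum>k<k. h k) - (\<Sum>k<i. h k)) + h k * L"
      using step.IH[OF tk] mult_left_mono[OF \<open>norm v \<le> L\<close> h[of k]] h[of k] by simp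
    finally show ?case by (simp add: algebra_simps)
  qed simp
  have mono: "(\<Sum>k<i. h k) \<le> (\<Sum>k<j. h k)" if "i \<le> j" for i j
    using that h by (intro sum_mono2) auto
  show ?thesis
    using main[of i j] main[of j i] mono[of i j] mono[of j i] S
    unfolding L_def[symmetric] by (cases "i \<le> j") (auto simp: norm_minus_commute)
qed

text \<open>The discrete counterpart of the derivative clause of \<open>half_solution\<close>, in
  the form that is passed to the limit.\<close>

lemma euler_support:
  fixes z x :: "nat \<Rightarrow> 'a" and h :: "nat \<Rightarrow> real"
  assumes h: "\<And>k. 0 \<le> h k"
    and z: "\<And>k. \<exists>v\<in>F (x k). z (Suc k) = z k + h k *\<^sub>R v"
    and c: "\<And>k v. i \<le> k \<Longrightarrow> k < j \<Longrightarrow> v \<in> F (x k) \<Longrightarrow> e \<bullet> v \<le> c"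
    and ij: "i \<le> j"
  shows "e \<bullet> (z j - z i) \<le> c * ((\<Sum>k<j. h k) - (\<Sum>k<i. h k))"
  using ij c
proof (induction j rule: dec_induct)
  case (step k)
  obtain v where v: "v \<in> F (x k)" "z (Suc k) = z k + h k *\<^sub>R v" using z by blast
  have "e \<bullet> v \<le> c" using step.prems[of k v] step.hyps v by auto
  then have "h k * (e \<bullet> v) \<le> h k * c" using h by (intro mult_left_mono)
  moreover have "e \<bullet> (z k - z i) \<le> c * ((\<Sum>k<k. h k) - (\<Sum>k<i. h k))"
    using step by auto
  ultimately show ?case by (simp add: v(2) algebra_simps inner_diff_right inner_add_right)
qed simp

end

section \<open>Elapsed time of a step sequence\<close>

lemma partial_sums_unbounded:
  fixes h :: "nat \<Rightarrow> real"
  assumes "\<And>k. 0 \<le> h k" "\<not> summable h"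
  shows "\<exists>k. s \<le> (\<Sum>i<k. h i)"
proof (rule ccontr)
  assume "\<not> ?thesis"
  then have "\<And>k. (\<Sum>i<k. h i) \<le> s" by (auto simp: not_le less_imp_le)
  then show False using summableI_nonneg_bounded[of h s] assms by auto
qed

text \<open>Serves to read a scheme as a step function of continuous time. With divergent steps the
  index exists for every \<open>s\<close>.\<close>

definition time_index :: "(nat \<Rightarrow> real) \<Rightarrow> real \<Rightarrow> nat" where
  "time_index h s = (LEAST k. s \<le> (\<Sum>i<k. h i))"

lemma time_index:
  assumes h: "\<And>k. 0 \<le> h k" "\<And>k. h k \<le> \<delta>" and ns: "\<not> summable h"
  shows time_index_ge: "s \<le> (\<Sum>i<time_index h s. h i)"
    and time_index_le: "0 \<le> s \<Longrightarrow> (\<Sum>i<time_index h s. h i) \<le> s + \<delta>"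
    and time_index_mono: "s \<le> s' \<Longrightarrow> time_index h s \<le> time_index h s'"
proof -
  show ge: "s \<le> (\<Sum>i<time_index h s. h i)" for s
    unfolding time_index_def by (rule LeastI_ex) (rule partial_sums_unbounded[OF h(1) ns])
  show "(\<Sum>i<time_index h s. h i) \<le> s + \<delta>" if "0 \<le> s"
  proof (cases "time_index h s")
    case 0
    have "0 \<le> \<delta>" using h[of 0] by linarith
    then show ?thesis using 0 that by simp
  next
    case (Suc k)
    then have "\<not> s \<le> (\<Sum>i<k. h i)" unfolding time_index_def by (intro not_less_Least) simp
    then show ?thesis using h(2)[of k] by (simp add: Suc)
  qed
  show "time_index h s \<le> time_index h s'" if "s \<le> s'"
    unfolding time_index_def[of h s] by (rule Least_le) (use that ge[of s'] in linarith)
qed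

lemma time_index_nonpos: "s \<le> 0 \<Longrightarrow> time_index h s = 0"
  unfolding time_index_def by (rule Least_eq_0) simp

context marchaud
begin

text \<open>With the noise subtracted, the schemes become step functions \<open>Z n\<close> of
  continuous time, which by the growth estimate live in a product of balls. Their Lipschitz and
  support estimates hold up to multiples of \<open>\<delta> n\<close> and therefore survive in a
  pointwise limit.\<close>

lemma half_solution_from_approximations:
  fixes x \<zeta> :: "nat \<Rightarrow> nat \<Rightarrow> 'a" and h :: "nat \<Rightarrow> nat \<Rightarrow> real"
  assumes \<delta>: "\<delta> \<longlonglongrightarrow> 0" "\<And>n. \<delta> n \<le> 1"
    and h: "\<And>n k. 0 \<le> h n k" "\<And>n k. h n k \<le> \<delta> n" "\<And>n. \<not> summable (h n)"
    and C: "compact C" "\<And>n. x n 0 \<in> C"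
    and rec: "\<And>n k. \<exists>v\<in>F (x n k). x n (Suc k) = x n k + h n k *\<^sub>R v + (\<zeta> n (Suc k) - \<zeta> n k)"
    and \<zeta>: "\<And>n. \<zeta> n 0 = 0" "\<And>n k. norm (\<zeta> n k) \<le> \<delta> n"
    and N: "0 \<le> T" "\<And>n. T \<le> (\<Sum>k<N n. h n k)" "\<And>n. (\<Sum>k<N n. h n k) \<le> T'"
  obtains y \<tau> G where "half_solution y" "y 0 \<in> C" "T \<le> \<tau>" "\<tau> \<le> T'"
    "G \<noteq> bot" "((\<lambda>n. x n (N n)) \<longlongrightarrow> y \<tau>) G"
proof -
  define z where "z n k = x n k - \<zeta> n k" for n k
  define t where "t n k = (\<Sum>i<k. h n i)" for n k
  define \<kappa> where "\<kappa> n s = time_index (h n) s" for n s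
  define Z where "Z n s = z n (\<kappa> n s)" for n s
  have zrec: "\<exists>v\<in>F (x n k). z n (Suc k) = z n k + h n k *\<^sub>R v" for n k
    using rec[of n k] by (auto simp: z_def algebra_simps)
  have xz: "norm (x n k) \<le> 1 + norm (z n k)" for n k
    using norm_triangle_ineq[of "z n k" "\<zeta> n k"] \<zeta>(2)[of n k] \<delta>(2)[of n] by (simp add: z_def)
  have z0: "z n 0 = x n 0" for n by (simp add: z_def \<zeta>)
  obtain B where B: "0 < B" "\<And>w. w \<in> C \<Longrightarrow> norm w \<le> B"
    using compact_imp_bounded[OF C(1)] bounded_pos by blast
  have \<kappa>_ge: "s \<le> t n (\<kappa> n s)" for n s
    unfolding t_def \<kappa>_def by (rule time_index_ge[OF h])
  have \<kappa>_le: "t n (\<kappa> n s) \<le> s + \<delta> n" if "0 \<le> s" for n s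
    unfolding t_def \<kappa>_def by (rule time_index_le[OF h that])
  have \<kappa>_mono: "\<kappa> n s \<le> \<kappa> n s'" if "s \<le> s'" for n s s'
    unfolding \<kappa>_def by (rule time_index_mono[OF h that])
  have \<kappa>_nonpos: "\<kappa> n s = 0" if "s \<le> 0" for n s
    unfolding \<kappa>_def using that by (rule time_index_nonpos)
  have \<delta>_nonneg: "0 \<le> \<delta> n" for n using h(1,2)[of n 0] by linarith
  define L where "L S = K * (exp (K * S) * (2 + B))" for S
  have L_pos: "0 < L S" for S using B K_pos by (auto simp: L_def intro!: mult_pos_pos)
  have zlip: "norm (z n i - z n j) \<le> L S * \<bar>t n i - t n j\<bar>" if "t n i \<le> S" "t n j \<le> S" for n i j S
    unfolding L_def t_def
    by (rule euler_lipschitz[where x="x n", OF h(1) zrec xz])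
       (use that C(2) B(2) in \<open>auto simp: t_def z0\<close>)
  \<comment> \<open>The time index overshoots by at most \<open>\<delta> n \<le> 1\<close>; hence
    \<open>S - 1\<close> here against \<open>S\<close> in \<open>zlip\<close>.\<close>
  have Zlip: "norm (Z n s' - Z n s) \<le> L S * (\<bar>s' - s\<bar> + \<delta> n)"
    if "0 \<le> s" "0 \<le> s'" "s \<le> S - 1" "s' \<le> S - 1" for n s s' S
  proof -
    have "norm (Z n s' - Z n s) \<le> L S * \<bar>t n (\<kappa> n s') - t n (\<kappa> n s)\<bar>"
      unfolding Z_def by (rule zlip) (use that \<kappa>_le[of s n] \<kappa>_le[of s' n] \<delta>(2)[of n] in auto)
    also have "\<dots> \<le> L S * (\<bar>s' - s\<bar> + \<delta> n)"
      using L_pos[of S] \<kappa>_le[of s n] \<kappa>_le[of s' n] \<kappa>_ge[of s n] \<kappa>_ge[of s' n] that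
      by (intro mult_left_mono) auto
    finally show ?thesis .
  qed
  \<comment> \<open>The product runs over all real times, hence the absolute value; the extra 1
    absorbs the overshoot.\<close>
  define R where "R s = exp (K * (\<bar>s\<bar> + 1)) * (2 + B)" for s
  have ZR: "Z n s \<in> cball 0 (R s)" for n s
  proof -
    have "2 + norm (Z n s) \<le> exp (K * t n (\<kappa> n s)) * (2 + norm (z n 0))"
      unfolding Z_def t_def by (rule euler_growth[where N="\<kappa> n s" and x="x n", OF h(1) zrec xz order_refl])
    also have "\<dots> \<le> R s"
    proof -
      have "t n (\<kappa> n s) \<le> \<bar>s\<bar> + 1"
        using \<kappa>_le[of s n] \<delta>(2)[of n] \<kappa>_nonpos[of s n] by (cases "0 \<le> s") (auto simp: t_def)
      then show ?thesis
        unfolding R_def using K_pos C(2)[of n] B(2) by (intro mult_mono) (auto simp: z0)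
    qed
    finally show ?thesis by simp
  qed
  \<comment> \<open>The end times cluster jointly with the interpolants, because the limit curve
    will be evaluated at the limit of the end times.\<close>
  obtain p G where p: "p \<in> PiE UNIV (\<lambda>s. cball 0 (R s)) \<times> {T..T'}"
    and G: "G \<noteq> bot" "G \<le> sequentially" "((\<lambda>n. (Z n, t n (N n))) \<longlongrightarrow> p) G"
  proof (rule compact_cluster_filter[of "PiE UNIV (\<lambda>s. cball 0 (R s)) \<times> {T..T'}" "\<lambda>n. (Z n, t n (N n))"])
    show "compact (PiE UNIV (\<lambda>s::real. cball (0::'a) (R s)) \<times> {T..T'})"
      by (intro compact_Times compact_PiE_UNIV) auto
    show "(Z n, t n (N n)) \<in> PiE UNIV (\<lambda>s. cball 0 (R s)) \<times> {T..T'}" for n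
      using ZR N by (auto simp: t_def)
  qed blast
  define y where "y = fst p"
  define \<tau> where "\<tau> = snd p"
  have \<tau>: "T \<le> \<tau>" "\<tau> \<le> T'" using p by (auto simp: \<tau>_def)
  have Zy: "((\<lambda>n. Z n s) \<longlongrightarrow> y s) G" for s
  proof -
    have "(Z \<longlongrightarrow> y) G" using tendsto_fst[OF G(3)] by (simp add: y_def)
    from continuous_on_tendsto_compose[OF continuous_on_product_coordinates this]
    show ?thesis by simp
  qed
  have tN: "((\<lambda>n. t n (N n)) \<longlongrightarrow> \<tau>) G" using tendsto_snd[OF G(3)] by (simp add: \<tau>_def)
  have \<delta>G: "(\<delta> \<longlongrightarrow> 0) G" using \<delta>(1) G(2) by (rule tendsto_mono[rotated])
  have y0: "y 0 \<in> C"
  proof (rule Lim_in_closed_set[OF compact_imp_closed[OF C(1)] _ G(1) Zy])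
    show "\<forall>\<^sub>F n in G. Z n 0 \<in> C" using C(2) by (simp add: Z_def \<kappa>_nonpos z0)
  qed
  have ylip: "norm (y s' - y s) \<le> L S * \<bar>s' - s\<bar>"
    if "0 \<le> s" "0 \<le> s'" "s \<le> S - 1" "s' \<le> S - 1" for s s' S
  proof (rule tendsto_le[OF G(1)])
    show "((\<lambda>n. L S * (\<bar>s' - s\<bar> + \<delta> n)) \<longlongrightarrow> L S * \<bar>s' - s\<bar>) G"
      using tendsto_mult[OF tendsto_const tendsto_add[OF tendsto_const \<delta>G], of "L S" "\<bar>s' - s\<bar>"] by simp
    show "((\<lambda>n. norm (Z n s' - Z n s)) \<longlongrightarrow> norm (y s' - y s)) G"
      by (intro tendsto_intros Zy)
    show "\<forall>\<^sub>F n in G. norm (Z n s' - Z n s) \<le> L S * (\<bar>s' - s\<bar> + \<delta> n)"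
      using Zlip[OF that] by simp
  qed
  have "half_solution y"
    unfolding half_solution_def
  proof (intro conjI allI impI)
    fix S :: real assume "0 \<le> S"
    have "(L (S + 1))-lipschitz_on {0..S} y"
      using ylip[of _ _ "S + 1"] L_pos[of "S+1"] by (intro lipschitz_onI) (auto simp: dist_norm)
    then show "\<exists>L. L-lipschitz_on {0..S} y" by blast
  next
    fix s :: real and e :: 'a and c :: real
    assume s: "0 \<le> s" and "\<forall>v\<in>F (y s). e \<bullet> v < c"
    then obtain \<epsilon> where \<epsilon>: "0 < \<epsilon>" "\<And>w v. w \<in> ball (y s) \<epsilon> \<Longrightarrow> v \<in> F w \<Longrightarrow> e \<bullet> v \<le> c"
      using support_upper_semicontinuous[of "y s" e c] by metis
    \<comment> \<open>Iterates read between \<open>s\<close> and \<open>r < s + d\<close> have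
      elapsed time at most \<open>r + \<delta> n \<le> s + 2\<close>. With this Lipschitz constant,
      \<open>d\<close> limits the drift to \<open>\<epsilon> / 4\<close>.\<close>
    define M where "M = L (s + 2)"
    have M: "0 < M" by (simp add: M_def L_pos)
    define d where "d = min 1 (\<epsilon> / (4 * M))"
    have d: "0 < d" "d \<le> 1" "M * d \<le> \<epsilon> / 4" using \<epsilon>(1) M by (auto simp: d_def min_def field_simps)
    have "e \<bullet> (y r - y s) \<le> c * (r - s)" if r: "s < r \<and> r < s + d" for r
    proof (rule tendsto_le[OF G(1)])
      show "((\<lambda>n. c * (r - s) + \<bar>c\<bar> * \<delta> n) \<longlongrightarrow> c * (r - s)) G"
        using tendsto_add[OF tendsto_const tendsto_mult[OF tendsto_const \<delta>G], of "c * (r - s)" "\<bar>c\<bar>"] by simp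
      show "((\<lambda>n. e \<bullet> (Z n r - Z n s)) \<longlongrightarrow> e \<bullet> (y r - y s)) G"
        by (intro tendsto_intros Zy)
      have "0 < \<epsilon> / (4 * (M + 1))" using \<epsilon>(1) M by simp
      then have "\<forall>\<^sub>F n in G. \<delta> n < \<epsilon> / (4 * (M + 1))" using order_tendstoD(2)[OF \<delta>G] by blast
      moreover have "\<forall>\<^sub>F n in G. dist (Z n s) (y s) < \<epsilon> / 4"
        by (rule tendstoD[OF Zy]) (use \<epsilon>(1) in simp)
      ultimately show "\<forall>\<^sub>F n in G. e \<bullet> (Z n r - Z n s) \<le> c * (r - s) + \<bar>c\<bar> * \<delta> n"
      proof eventually_elim
        case (elim n)
        \<comment> \<open>The budget: a quarter of \<open>\<epsilon>\<close> for the drift, one for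
          the distance of \<open>Z n s\<close> from its limit, and this one for overshoot and
          noise.\<close>
        have \<delta>M: "M * \<delta> n + \<delta> n \<le> \<epsilon> / 4" using elim(1) M by (simp add: field_simps)
        have "e \<bullet> (Z n r - Z n s) \<le> c * (t n (\<kappa> n r) - t n (\<kappa> n s))"
          unfolding Z_def t_def
        proof (rule euler_support[where x="x n", OF h(1) zrec])
          show "\<kappa> n s \<le> \<kappa> n r" using r \<kappa>_mono by simp
          fix k v assume k: "\<kappa> n s \<le> k" "k < \<kappa> n r" and v: "v \<in> F (x n k)"
          have tmono: "t n i \<le> t n j" if "i \<le> j" for i j
            unfolding t_def using that h(1) by (intro sum_mono2) auto
          have tk: "t n (\<kappa> n s) \<le> t n k" "t n k \<le> r + \<delta> n"
            using tmono[OF k(1)] tmono[of k "\<kappa> n r"] k \<kappa>_le[of r n] s r by auto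
          have "norm (z n k - Z n s) \<le> M * \<bar>t n k - t n (\<kappa> n s)\<bar>"
            unfolding Z_def M_def by (rule zlip) (use tk r d \<delta>(2)[of n] in auto)
          also have "\<dots> \<le> M * (d + \<delta> n)"
            using tk M r \<kappa>_ge[of s n] by (intro mult_left_mono) auto
          finally have "norm (z n k - Z n s) \<le> \<epsilon> / 4 + M * \<delta> n" using d by (simp add: algebra_simps)
          moreover have "norm (x n k - z n k) \<le> \<delta> n" using \<zeta>(2)[of n k] by (simp add: z_def)
          ultimately have "dist (x n k) (y s) < \<epsilon>"
            using elim(2) \<delta>M \<epsilon>(1) dist_triangle[of "x n k" "y s" "z n k"] dist_triangle[of "z n k" "y s" "Z n s"]
            by (simp add: dist_norm)
          then show "e \<bullet> v \<le> c" using \<epsilon>(2)[of "x n k" v] v by (simp add: dist_commute)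
        qed
        \<comment> \<open>\<open>c\<close> may be negative, so the mismatch between elapsed time and
          \<open>r - s\<close> is paid with \<open>\<bar>c\<bar> * \<delta> n\<close>.\<close>
        also have "\<dots> = c * (r - s) + c * ((t n (\<kappa> n r) - t n (\<kappa> n s)) - (r - s))" by (simp add: algebra_simps)
        also have "\<dots> \<le> c * (r - s) + \<bar>c\<bar> * \<delta> n"
        proof -
          have "\<bar>(t n (\<kappa> n r) - t n (\<kappa> n s)) - (r - s)\<bar> \<le> \<delta> n"
            using \<kappa>_le[of s n] \<kappa>_le[of r n] \<kappa>_ge[of s n] \<kappa>_ge[of r n] s r by auto
          then have "\<bar>c * ((t n (\<kappa> n r) - t n (\<kappa> n s)) - (r - s))\<bar> \<le> \<bar>c\<bar> * \<delta> n"
            unfolding abs_mult by (intro mult_left_mono) auto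
          then show ?thesis by linarith
        qed
        finally show ?case .
      qed
    qed
    then show "\<exists>d>0. \<forall>t. s < t \<and> t < s + d \<longrightarrow> e \<bullet> (y t - y s) \<le> c * (t - s)" using d(1) by blast
  qed
  moreover have "((\<lambda>n. x n (N n)) \<longlongrightarrow> y \<tau>) G"
  proof -
    \<comment> \<open>The end point belongs to a time that moves with \<open>n\<close>; the common
      Lipschitz bound replaces it by the interpolant at the fixed time
      \<open>\<tau>\<close>.\<close>
    have "((\<lambda>n. x n (N n) - Z n \<tau>) \<longlongrightarrow> 0) G"
    proof (rule Lim_null_comparison)
      show "((\<lambda>n. L (T' + 1) * (\<bar>t n (N n) - \<tau>\<bar> + \<delta> n) + \<delta> n) \<longlongrightarrow> 0) G"
        using tendsto_add[OF tendsto_mult[OF tendsto_const tendsto_add[OF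
            tendsto_rabs[OF tendsto_diff[OF tN tendsto_const]] \<delta>G]] \<delta>G, of "L (T' + 1)" \<tau>] by simp
      have "norm (x n (N n) - Z n \<tau>) \<le> L (T' + 1) * (\<bar>t n (N n) - \<tau>\<bar> + \<delta> n) + \<delta> n" for n
      proof -
        have "0 \<le> \<tau>" using N(1) \<tau> by simp
        have "norm (z n (N n) - Z n \<tau>) \<le> L (T' + 1) * \<bar>t n (N n) - t n (\<kappa> n \<tau>)\<bar>"
          unfolding Z_def by (rule zlip)
            (use N(3)[of n] \<kappa>_le[OF \<open>0 \<le> \<tau>\<close>, of n] \<tau> \<delta>(2)[of n] in \<open>auto simp: t_def\<close>)
        also have "\<dots> \<le> L (T' + 1) * (\<bar>t n (N n) - \<tau>\<bar> + \<delta> n)"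
          using \<kappa>_le[OF \<open>0 \<le> \<tau>\<close>, of n] \<kappa>_ge[of \<tau> n] L_pos[of "T' + 1"] by (intro mult_left_mono) auto
        finally show ?thesis
          using norm_triangle_ineq[of "z n (N n) - Z n \<tau>" "\<zeta> n (N n)"] \<zeta>(2)[of n "N n"]
          by (simp add: z_def)
      qed
      then show "\<forall>\<^sub>F n in G. norm (x n (N n) - Z n \<tau>) \<le> L (T' + 1) * (\<bar>t n (N n) - \<tau>\<bar> + \<delta> n) + \<delta> n"
        by simp
    qed
    from tendsto_add[OF this Zy[of \<tau>]] show ?thesis by simp
  qed
  ultimately show thesis using that y0 \<tau> G(1) by blast
qed

text \<open>Continues a finite scheme without noise by a selection of \<open>F\<close>, since
  \<open>half_solution_from_approximations\<close> expects infinite sequences.\<close>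

lemma euler_sequence_exists:
  fixes h :: "nat \<Rightarrow> real" and x :: "nat \<Rightarrow> 'a"
  obtains x' where "\<And>k. k \<le> N \<Longrightarrow> x' k = x k" "\<And>k. N \<le> k \<Longrightarrow> \<exists>v\<in>F (x' k). x' (Suc k) = x' k + h k *\<^sub>R v"
proof -
  have "\<forall>w. \<exists>v. v \<in> F w" using nonempty by blast
  then obtain sel where sel: "\<And>w. sel w \<in> F w" by metis
  define x' where "x' = rec_nat (x 0) (\<lambda>k w. if k < N then x (Suc k) else w + h k *\<^sub>R sel w)"
  have x': "x' 0 = x 0" "x' (Suc k) = (if k < N then x (Suc k) else x' k + h k *\<^sub>R sel (x' k))" for k
    by (simp_all add: x'_def)
  show thesis
  proof
    show "x' k = x k" if "k \<le> N" for k using that by (cases k) (auto simp: x')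
    show "\<exists>v\<in>F (x' k). x' (Suc k) = x' k + h k *\<^sub>R v" if "N \<le> k" for k
      using that sel by (auto simp: x')
  qed
qed

lemma half_solution_exists:
  obtains y where "half_solution y" "y 0 = x0"
proof -
  define h where "h n k = inverse (real (Suc n))" for n k :: nat
  have "\<exists>x. x 0 = x0 \<and> (\<forall>k. \<exists>v\<in>F (x k). x (Suc k) = x k + h n k *\<^sub>R v)" for n
    using euler_sequence_exists[of 0 "\<lambda>_. x0" "h n"] by (metis le0)
  then obtain x where x: "\<And>n. x n 0 = x0" "\<And>n k. \<exists>v\<in>F (x n k). x n (Suc k) = x n k + h n k *\<^sub>R v"
    by metis
  obtain y \<tau> G where "half_solution y" "y 0 \<in> {x0}"
  \<comment> \<open>Noise-free schemes from \<open>x0\<close>; only the limit curve is wanted here,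
    so the end-time data are set to 0.\<close>
  proof (rule half_solution_from_approximations[of "\<lambda>n. inverse (real (Suc n))" h "{x0}" x "\<lambda>_ _. 0" 0 "\<lambda>_. 0" 0])
    show "\<not> summable (h n)" for n
      unfolding h_def by (simp add: summable_const_iff)
    show "(\<lambda>n. inverse (real (Suc n))) \<longlonglongrightarrow> 0" by (rule LIMSEQ_inverse_real_of_nat)
    show "inverse (real (Suc n)) \<le> 1" for n by (simp add: field_simps)
  qed (use x in \<open>auto simp: h_def\<close>)
  then show thesis using that by auto
qed

text \<open>Left of 0 the curve is a time-reversed half solution of \<open>- F\<close>. Both pieces
  are Lipschitz on bounded intervals, so the glued curve is absolutely continuous and differentiable
  almost everywhere.\<close>

lemma half_solution_extends:
  assumes y: "half_solution y" and t: "0 \<le> t"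
  shows "y t \<in> DI_flow F t (y 0)"
proof -
  interpret neg: marchaud "\<lambda>x. uminus ` F x" K by (rule marchaud_uminus)
  obtain w where w: "neg.half_solution w" "w 0 = y 0" by (rule neg.half_solution_exists)
  define x where "x s = (if s \<le> 0 then w (- s) else y s)" for s
  have lip: "\<exists>L. L-lipschitz_on {-R..R} x" if R: "0 \<le> R" for R
  proof -
    obtain L1 L2 where L: "L1-lipschitz_on {0..R} w" "L2-lipschitz_on {0..R} y"
      using neg.half_solution_lipschitz[OF w(1) R] half_solution_lipschitz[OF y R] by blast
    have "L1-lipschitz_on {-R..0} (\<lambda>s. w (- s))"
    proof (rule lipschitz_onI)
      fix s s' :: real assume "s \<in> {-R..0}" "s' \<in> {-R..0}"
      then show "dist (w (- s)) (w (- s')) \<le> L1 * dist s s'"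
        using lipschitz_onD[OF L(1), of "- s" "- s'"] by (simp add: dist_minus)
    qed (rule lipschitz_on_nonneg[OF L(1)])
    from lipschitz_on_concat_max[OF this L(2)] show ?thesis
      unfolding x_def using w(2) by auto
  qed
  have "abs_cont x"
    unfolding abs_cont_def abs_cont_on_interval_def
  proof (intro allI impI)
    fix a b \<epsilon> :: real assume "a \<le> b" "0 < \<epsilon>"
    define R where "R = max \<bar>a\<bar> \<bar>b\<bar>"
    have "0 \<le> R" by (simp add: R_def le_max_iff_disj)
    then obtain L where L: "L-lipschitz_on {-R..R} x" using lip by blast
    have L0: "0 \<le> L" by (rule lipschitz_on_nonneg[OF L])
    show "\<exists>\<delta>>0. \<forall>(n::nat) u v. (\<forall>i<n. a \<le> u i \<and> u i \<le> v i \<and> v i \<le> b) \<longrightarrow>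
        (\<forall>i<n. \<forall>j<n. i \<noteq> j \<longrightarrow> v i \<le> u j \<or> v j \<le> u i) \<longrightarrow>
        (\<Sum>i<n. v i - u i) < \<delta> \<longrightarrow> (\<Sum>i<n. norm (x (v i) - x (u i))) < \<epsilon>"
    proof (rule exI[of _ "\<epsilon> / (L + 1)"], intro conjI allI impI)
      show "0 < \<epsilon> / (L + 1)" using L0 \<open>0 < \<epsilon>\<close> by simp
      fix n :: nat and u v :: "nat \<Rightarrow> real"
      assume uv: "\<forall>i<n. a \<le> u i \<and> u i \<le> v i \<and> v i \<le> b" and s: "(\<Sum>i<n. v i - u i) < \<epsilon> / (L + 1)"
      have "norm (x (v i) - x (u i)) \<le> L * (v i - u i)" if "i < n" for i
      proof -
        have "u i \<in> {-R..R}" "v i \<in> {-R..R}" "u i \<le> v i" using uv that by (force simp: R_def)+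
        then show ?thesis using lipschitz_onD[OF L, of "v i" "u i"] by (simp add: dist_norm)
      qed
      then have "(\<Sum>i<n. norm (x (v i) - x (u i))) \<le> L * (\<Sum>i<n. v i - u i)"
        unfolding sum_distrib_left by (intro sum_mono) auto
      also have "\<dots> \<le> (L + 1) * (\<Sum>i<n. v i - u i)"
        using uv by (intro mult_right_mono sum_nonneg) auto
      also have "\<dots> < \<epsilon>" using s L0 by (simp add: field_simps)
      finally show "(\<Sum>i<n. norm (x (v i) - x (u i))) < \<epsilon>" .
    qed
  qed
  \<comment> \<open>The point 0 is discarded because each piece controls derivatives only on its own
    side of it.\<close>
  moreover have "AE s in lborel. \<exists>v. (x has_vector_derivative v) (at s) \<and> v \<in> F (x s)"
    using locally_lipschitz_AE_vector_derivative[OF lip[OF of_nat_0_le_iff]] AE_lborel_singleton[of 0]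
  proof eventually_elim
    case (elim s)
    then obtain v where v: "(x has_vector_derivative v) (at s)" by blast
    have "v \<in> F (x s)"
    proof (cases "0 < s")
      case True
      have "(y has_vector_derivative v) (at s)"
        by (rule has_vector_derivative_transform_within_open[OF v, of "{0<..}"])
           (use True in \<open>auto simp: x_def\<close>)
      from half_solution_derivative[OF y _ this] True show ?thesis by (simp add: x_def)
    next
      case False
      then have s: "s < 0" using elim by auto
      have "((x \<circ> uminus) has_vector_derivative (- 1) *\<^sub>R v) (at (- s))"
        by (rule vector_diff_chain_at) (use v in \<open>auto intro!: derivative_eq_intros\<close>)
      then have "((x \<circ> uminus) has_vector_derivative - v) (at (- s))" by simp
      from has_vector_derivative_transform_within_open[OF this, of "{0<..}"]
      have "(w has_vector_derivative - v) (at (- s))"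
        using s by (auto simp: x_def)
      from neg.half_solution_derivative[OF w(1) _ this] s show ?thesis by (auto simp: x_def)
    qed
    with v show ?case by blast
  qed
  ultimately have "DI_solution F (y 0) x" by (simp add: DI_solution_def x_def w(2))
  moreover have "x t = y t" using t w(2) by (cases "t = 0") (auto simp: x_def)
  ultimately show ?thesis unfolding DI_flow_def by (intro CollectI exI[of _ x]) simp
qed

end

section \<open>Tracking of solutions by perturbed Euler schemes\<close>

lemma open_eps_nbhd: "open (eps_nbhd \<epsilon> A)"
proof -
  have "eps_nbhd \<epsilon> A = (\<Union>z\<in>A. ball z \<epsilon>)" by (auto simp: eps_nbhd_def dist_commute)
  then show ?thesis by auto
qed

context marchaud
begin

text \<open>Noise enters through the increments of an accumulated sum, so smallness can be asked of
  its oscillation rather than of single terms.\<close>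

definition perturbed_euler :: "(nat \<Rightarrow> real) \<Rightarrow> (nat \<Rightarrow> 'a) \<Rightarrow> (nat \<Rightarrow> 'a) \<Rightarrow> nat \<Rightarrow> bool" where
  "perturbed_euler h \<zeta> x N \<longleftrightarrow>
     (\<forall>k<N. \<exists>v\<in>F (x k). x (Suc k) = x k + h k *\<^sub>R v + (\<zeta> (Suc k) - \<zeta> k))"

text \<open>The divergent sum gives every scheme a clock for all times, as the interpolation
  requires. Noise is measured relative to its initial value so that windows of a longer run
  qualify.\<close>

definition tracked :: "real \<Rightarrow> 'a set \<Rightarrow> real \<Rightarrow> real \<Rightarrow> 'a set \<Rightarrow> bool" where
  "tracked \<delta> C T T' V \<longleftrightarrow>
     (\<forall>h \<zeta> x N. (\<forall>k. 0 \<le> h k \<and> h k \<le> \<delta>) \<and> \<not> summable h \<and> x 0 \<in> C \<and>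
        perturbed_euler h \<zeta> x N \<and> (\<forall>k\<le>N. norm (\<zeta> k - \<zeta> 0) \<le> \<delta>) \<and>
        T \<le> (\<Sum>k<N. h k) \<and> (\<Sum>k<N. h k) \<le> T' \<longrightarrow> x N \<in> V)"

text \<open>\<open>T\<close> is the attraction time for \<open>\<epsilon>\<close>; only
  \<open>\<delta>\<close> depends on the horizon \<open>T'\<close>. If no \<open>\<delta>\<close>
  worked, bad schemes with tolerance tending to 0 would cluster at a half solution started in
  \<open>C\<close>. Its value at some \<open>\<tau> \<ge> T\<close> lies in the open neighbourhood
  of \<open>A\<close>, so some bad scheme would end there too.\<close>

lemma tracking:
  assumes attr: "attracting_set F A U" and C: "compact C" "C \<subseteq> U" and \<epsilon>: "0 < \<epsilon>"
  obtains T where "0 < T"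
    "\<And>T'. \<exists>\<delta>>0. tracked \<delta> C T T' (eps_nbhd \<epsilon> A)"
proof -
  obtain T where T: "0 < T" "\<And>t w. T \<le> t \<Longrightarrow> w \<in> U \<Longrightarrow> DI_flow F t w \<subseteq> eps_nbhd \<epsilon> A"
    using attr \<epsilon> unfolding attracting_set_def by metis
  have "\<exists>\<delta>>0. tracked \<delta> C T T' (eps_nbhd \<epsilon> A)" for T'
  proof (rule ccontr)
    define bad where "bad \<delta> h \<zeta> x N \<longleftrightarrow> (\<forall>k. 0 \<le> h k \<and> h k \<le> \<delta>) \<and> \<not> summable h \<and> x 0 \<in> C \<and>
        perturbed_euler h \<zeta> x N \<and> (\<forall>k\<le>N. norm (\<zeta> k - \<zeta> 0) \<le> \<delta>) \<and>
        T \<le> (\<Sum>k<N. h k) \<and> (\<Sum>k<N. h k) \<le> T' \<and> x N \<notin> eps_nbhd \<epsilon> A" for \<delta> h \<zeta> x N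
    assume "\<not> ?thesis"
    moreover have "0 < inverse (real (Suc n))" for n by simp
    ultimately have "\<not> tracked (inverse (real (Suc n))) C T T' (eps_nbhd \<epsilon> A)" for n by blast
    then have "\<exists>h \<zeta> x N. bad (inverse (real (Suc n))) h \<zeta> x N" for n
      unfolding tracked_def bad_def by (simp only: not_all not_imp conj_assoc)
    then obtain h \<zeta> x N where bad: "\<And>n. bad (inverse (real (Suc n))) (h n) (\<zeta> n) (x n) (N n)"
      by metis
    have "\<forall>n. \<exists>x'. (\<forall>k\<le>N n. x' k = x n k) \<and> (\<forall>k\<ge>N n. \<exists>v\<in>F (x' k). x' (Suc k) = x' k + h n k *\<^sub>R v)"
      using euler_sequence_exists by metis
    then obtain x' where x': "\<And>n k. k \<le> N n \<Longrightarrow> x' n k = x n k"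
      "\<And>n k. N n \<le> k \<Longrightarrow> \<exists>v\<in>F (x' n k). x' n (Suc k) = x' n k + h n k *\<^sub>R v"
      by metis
    \<comment> \<open>The noise is normalised to start at 0 and frozen after \<open>N n\<close>,
      where the noiseless continuation takes over.\<close>
    define \<zeta>' where "\<zeta>' n k = \<zeta> n (min k (N n)) - \<zeta> n 0" for n k
    obtain y \<tau> G where y: "half_solution y" "y 0 \<in> C" "T \<le> \<tau>" "G \<noteq> bot" "((\<lambda>n. x' n (N n)) \<longlongrightarrow> y \<tau>) G"
    proof (rule half_solution_from_approximations[of "\<lambda>n. inverse (real (Suc n))" h C x' \<zeta>' T N T'])
      show "(\<lambda>n. inverse (real (Suc n))) \<longlonglongrightarrow> 0" by (rule LIMSEQ_inverse_real_of_nat)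
      show "inverse (real (Suc n)) \<le> 1" for n by (simp add: field_simps)
      show "0 \<le> h n k" "h n k \<le> inverse (real (Suc n))" "\<not> summable (h n)" "T \<le> (\<Sum>k<N n. h n k)"
        "(\<Sum>k<N n. h n k) \<le> T'" for n k
        using bad[of n] by (auto simp: bad_def)
      show "compact C" "0 \<le> T" using C T by auto
      show "x' n 0 \<in> C" for n using bad[of n] by (auto simp: bad_def x')
      show "\<zeta>' n 0 = 0" for n by (simp add: \<zeta>'_def)
      show "norm (\<zeta>' n k) \<le> inverse (real (Suc n))" for n k
        using bad[of n] by (auto simp: bad_def \<zeta>'_def)
      show "\<exists>v\<in>F (x' n k). x' n (Suc k) = x' n k + h n k *\<^sub>R v + (\<zeta>' n (Suc k) - \<zeta>' n k)" for n k
      proof (cases "k < N n")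
        case True
        then have "\<exists>v\<in>F (x n k). x n (Suc k) = x n k + h n k *\<^sub>R v + (\<zeta> n (Suc k) - \<zeta> n k)"
          using bad[of n] by (auto simp: bad_def perturbed_euler_def)
        then show ?thesis using True by (auto simp: x' \<zeta>'_def min_def)
      next
        case False
        then show ?thesis using x'(2)[of n k] by (auto simp: \<zeta>'_def min_def)
      qed
    qed blast
    have "y \<tau> \<in> DI_flow F \<tau> (y 0)"
      using half_solution_extends[OF y(1)] y(3) T(1) by simp
    then have "y \<tau> \<in> eps_nbhd \<epsilon> A" using T(2)[OF y(3), of "y 0"] y(2) C(2) by blast
    then have "\<forall>\<^sub>F n in G. x' n (N n) \<in> eps_nbhd \<epsilon> A"
      by (rule topological_tendstoD[OF y(5) open_eps_nbhd])
    then obtain n where "x' n (N n) \<in> eps_nbhd \<epsilon> A"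
      using eventually_happens[of _ G] y(4) by blast
    then show False using bad[of n] by (simp add: bad_def x')
  qed
  then show thesis using that T(1) by blast
qed

section \<open>Windows of a longer run\<close>

lemma perturbed_euler_shift:
  assumes "\<And>k. i \<le> k \<Longrightarrow> k < n \<Longrightarrow> \<exists>v\<in>F (x k). x (Suc k) = x k + h k *\<^sub>R v + (\<zeta> (Suc k) - \<zeta> k)"
  shows "perturbed_euler (\<lambda>k. h (i + k)) (\<lambda>k. \<zeta> (i + k)) (\<lambda>k. x (i + k)) (n - i)"
  unfolding perturbed_euler_def using assms by auto

lemma perturbed_euler_growth:
  assumes e: "perturbed_euler h \<zeta> x N" and h: "\<And>k. k < N \<Longrightarrow> 0 \<le> h k"
    and \<zeta>: "\<And>k. k \<le> N \<Longrightarrow> norm (\<zeta> k - \<zeta> 0) \<le> 1"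
  shows "norm (x N) \<le> exp (K * (\<Sum>k<N. h k)) * (2 + norm (x 0))"
proof -
  define z where "z k = x k - (\<zeta> k - \<zeta> 0)" for k
  have "norm (x k) \<le> 1 + norm (z k)" if "k \<le> N" for k
    using norm_triangle_ineq[of "z k" "\<zeta> k - \<zeta> 0"] \<zeta>[OF that] by (simp add: z_def)
  moreover have "\<exists>v\<in>F (x k). z (Suc k) = z k + h k *\<^sub>R v" if "k < N" for k
    using e that by (fastforce simp: perturbed_euler_def z_def)
  ultimately have "2 + norm (z N) \<le> exp (K * (\<Sum>k<N. h k)) * (2 + norm (z 0))"
    by (intro euler_growth[where x=x and N=N] h) auto
  moreover have "norm (x N) \<le> 1 + norm (z N)" using \<open>\<And>k. k \<le> N \<Longrightarrow> norm (x k) \<le> 1 + norm (z k)\<close> by simp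
  ultimately show ?thesis by (simp add: z_def)
qed

end

lemma sum_shift_diff:
  fixes h :: "nat \<Rightarrow> 'b::ab_group_add"
  assumes "i \<le> n"
  shows "(\<Sum>k<n - i. h (i + k)) = (\<Sum>k<n. h k) - (\<Sum>k<i. h k)"
  using assms
proof (induction n rule: dec_induct)
  case (step n)
  then show ?case by (simp add: Suc_diff_le)
qed simp

context marchaud
begin

text \<open>The deterministic half, for one trajectory. While the iterates are in the ball, the
  increments of \<open>\<zeta>\<close> are the true noise and tracking applies; tracking in turn
  keeps the iterates in the ball. Induction on time resolves the circle.\<close>

lemma convergence_to_attractor:
  assumes attr: "attracting_set F A U"
    and U': "open U'" "A \<subseteq> U'" "compact (closure U')" "closure U' \<subseteq> U"
  obtains R \<delta> where "0 < \<delta>" "0 < R"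
    "\<And>a X M \<zeta> n0.
      (\<And>k. 0 < a k) \<Longrightarrow> \<not> summable a \<Longrightarrow> a \<longlonglongrightarrow> 0 \<Longrightarrow>
      (\<And>k. \<exists>v\<in>F (X k). X (Suc k) = X k + a k *\<^sub>R v + a k *\<^sub>R M (Suc k)) \<Longrightarrow>
      (\<And>m. \<zeta> m = (\<Sum>k<m. if norm (X k) \<le> R then a k *\<^sub>R M (Suc k) else 0)) \<Longrightarrow>
      X n0 \<in> U' \<Longrightarrow> (\<And>k. n0 \<le> k \<Longrightarrow> a k \<le> \<delta>) \<Longrightarrow>
      (\<And>m. n0 \<le> m \<Longrightarrow> norm (\<zeta> m - \<zeta> n0) \<le> \<delta>) \<Longrightarrow>
      (\<And>\<epsilon>. 0 < \<epsilon> \<Longrightarrow> \<exists>n. \<forall>m\<ge>n. norm (\<zeta> m - \<zeta> n) \<le> \<epsilon>) \<Longrightarrow>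
      (\<lambda>n. infdist (X n) A) \<longlonglongrightarrow> 0"
proof -
  have A: "compact A" using attr by (simp add: attracting_set_def)
  obtain \<epsilon>0 where \<epsilon>0: "0 < \<epsilon>0" "(\<Union>z\<in>A. cball z \<epsilon>0) \<subseteq> U'"
    using compact_subset_open_imp_cball_epsilon_subset[OF A U'(1,2)] by blast
  then have nbhd: "eps_nbhd \<epsilon>0 A \<subseteq> U'"
    by (force simp: eps_nbhd_def dist_commute)
  obtain T where T: "0 < T" "\<And>T'. \<exists>\<delta>>0. tracked \<delta> (closure U') T T' (eps_nbhd \<epsilon>0 A)"
    using tracking[OF attr U'(3,4) \<epsilon>0(1)] by blast
  obtain \<delta>1 where \<delta>1: "0 < \<delta>1" "tracked \<delta>1 (closure U') T (T + 1) (eps_nbhd \<epsilon>0 A)"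
    using T(2)[of "T + 1"] by blast
  obtain B where B: "0 < B" "\<And>w. w \<in> closure U' \<Longrightarrow> norm w \<le> B"
    using compact_imp_bounded[OF U'(3)] bounded_pos by blast
  \<comment> \<open>The Gronwall bound for a run of duration at most \<open>T + 1\<close> started in
    \<open>U'\<close>.\<close>
  define R where "R = exp (K * (T + 1)) * (2 + B)"
  \<comment> \<open>Between two times after \<open>n0\<close> the noise moves by at most
    \<open>2 * \<delta>\<close>, which has to respect both the tracking tolerance and the 1 in
    \<open>perturbed_euler_growth\<close>. Steps of at most 1/2 cannot jump over a time window of
    length 1.\<close>
  define \<delta> where "\<delta> = min (\<delta>1 / 2) (1 / 2)"
  have \<delta>: "0 < \<delta>" "2 * \<delta> \<le> \<delta>1" "2 * \<delta> \<le> 1" using \<delta>1(1) by (auto simp: \<delta>_def)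
  have R: "0 < R" using B by (simp add: R_def)
  show thesis
  proof (rule that[of \<delta> R])
    fix a :: "nat \<Rightarrow> real" and X M \<zeta> :: "nat \<Rightarrow> 'a" and n0 :: nat
    assume a: "\<And>k. 0 < a k" "\<not> summable a" "a \<longlonglongrightarrow> 0"
      and rec: "\<And>k. \<exists>v\<in>F (X k). X (Suc k) = X k + a k *\<^sub>R v + a k *\<^sub>R M (Suc k)"
      and \<zeta>: "\<And>m. \<zeta> m = (\<Sum>k<m. if norm (X k) \<le> R then a k *\<^sub>R M (Suc k) else 0)"
      and X0: "X n0 \<in> U'" and a\<delta>: "\<And>k. n0 \<le> k \<Longrightarrow> a k \<le> \<delta>"
      and \<zeta>\<delta>: "\<And>m. n0 \<le> m \<Longrightarrow> norm (\<zeta> m - \<zeta> n0) \<le> \<delta>"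
      and Cau: "\<And>\<epsilon>. 0 < \<epsilon> \<Longrightarrow> \<exists>n. \<forall>m\<ge>n. norm (\<zeta> m - \<zeta> n) \<le> \<epsilon>"
    define t where "t n = (\<Sum>k<n. a k)" for n
    have t_diff: "(\<Sum>k<n - j. a (j + k)) = t n - t j" if "j \<le> n" for j n
      unfolding t_def by (rule sum_shift_diff[OF that])
    have t_mono: "strict_mono t" unfolding strict_mono_Suc_iff t_def using a(1) by simp
    have a_tail: "\<not> summable (\<lambda>k. a (j + k))" for j
      using a(2) summable_iff_shift[of a j] by (simp add: add.commute)
    have window: "perturbed_euler (\<lambda>k. a (j + k)) (\<lambda>k. \<zeta> (j + k)) (\<lambda>k. X (j + k)) (n - j)"
      if "\<And>k. j \<le> k \<Longrightarrow> k < n \<Longrightarrow> norm (X k) \<le> R" for j n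
      by (rule perturbed_euler_shift) (use rec that in \<open>auto simp: \<zeta>\<close>)
    have osc: "norm (\<zeta> k - \<zeta> j) \<le> 2 * e"
      if "norm (\<zeta> k - \<zeta> n) \<le> e" "norm (\<zeta> j - \<zeta> n) \<le> e" for e j k n
      using norm_triangle_ineq4[of "\<zeta> k - \<zeta> n" "\<zeta> j - \<zeta> n"] that by simp
    have track: "X n \<in> V"
      if tr: "tracked e (closure U') S S' V" and j: "j \<le> n" "X j \<in> U'"
        and ae: "\<And>k. j \<le> k \<Longrightarrow> a k \<le> e" and \<zeta>e: "\<And>k. j \<le> k \<Longrightarrow> norm (\<zeta> k - \<zeta> j) \<le> e"
        and S: "S \<le> t n - t j" "t n - t j \<le> S'"
        and bd: "\<And>k. j \<le> k \<Longrightarrow> k < n \<Longrightarrow> norm (X k) \<le> R" for e S S' V j n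
      using tr[unfolded tracked_def, rule_format,
          of "\<lambda>k. a (j + k)" "\<lambda>k. X (j + k)" "\<lambda>k. \<zeta> (j + k)" "n - j"]
        window[OF bd] j ae \<zeta>e S a_tail[of j] t_diff[OF j(1)] a(1)
        closure_subset[of U'] by (auto simp: less_imp_le)
    \<comment> \<open>The bound is claimed only for \<open>k < n\<close>: a window ending at
      \<open>n\<close> uses the noise of earlier steps alone, and Gronwall then bounds
      \<open>X n\<close>.\<close>
    have Q: "(\<forall>k. n0 \<le> k \<and> k < n \<longrightarrow> norm (X k) \<le> R) \<and>
             (\<exists>j. n0 \<le> j \<and> j \<le> n \<and> X j \<in> U' \<and> t n - t j \<le> T + 1)" if "n0 \<le> n" for n
      using that
    proof (induction n rule: dec_induct)
      case base
      then show ?case using X0 T(1) by auto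
    next
      case (step n)
      then have bd: "\<And>k. n0 \<le> k \<Longrightarrow> k < n \<Longrightarrow> norm (X k) \<le> R" by blast
      from step obtain j where j: "n0 \<le> j" "j \<le> n" "X j \<in> U'" "t n - t j \<le> T + 1" by blast
      have \<zeta>j: "norm (\<zeta> k - \<zeta> j) \<le> 2 * \<delta>" if "j \<le> k" for k
        by (rule osc[OF \<zeta>\<delta> \<zeta>\<delta>]) (use that j in auto)
      have \<zeta>j1: "norm (\<zeta> k - \<zeta> j) \<le> 1" if "j \<le> k" for k using \<zeta>j[OF that] \<delta> by linarith
      have bdj: "norm (X k) \<le> R" if "j \<le> k" "k < n" for k using bd that j by simp
      have "norm (X (j + (n - j))) \<le> exp (K * (\<Sum>k<n - j. a (j + k))) * (2 + norm (X (j + 0)))"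
        by (rule perturbed_euler_growth[OF window[OF bdj]])
          (use a(1) \<zeta>j1 in \<open>auto simp: less_imp_le\<close>)
      then have "norm (X n) \<le> exp (K * (t n - t j)) * (2 + norm (X j))"
        using j(2) by (simp add: t_diff)
      also have "\<dots> \<le> R"
        unfolding R_def using j K_pos B closure_subset[of U'] by (intro mult_mono) auto
      finally have Xn: "norm (X n) \<le> R" .
      \<comment> \<open>If the visit at \<open>j\<close> becomes too old with the next step, then
        \<open>t n - t j\<close> already lies between \<open>T\<close> and \<open>T + 1\<close>, and
        \<open>n\<close> itself is a new visit.\<close>
      have "\<exists>j. n0 \<le> j \<and> j \<le> Suc n \<and> X j \<in> U' \<and> t (Suc n) - t j \<le> T + 1"
      proof (cases "t (Suc n) - t j \<le> T + 1")
        case True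
        then show ?thesis using j by (intro exI[of _ j]) auto
      next
        case False
        have an: "a n \<le> \<delta>" using a\<delta> step by simp
        then have "T \<le> t n - t j" using False \<delta> by (simp add: t_def)
        have "X n \<in> eps_nbhd \<epsilon>0 A"
        proof (rule track[OF \<delta>1(2) j(2,3) _ _ \<open>T \<le> t n - t j\<close> j(4) bdj])
          show "a k \<le> \<delta>1" if "j \<le> k" for k using a\<delta>[of k] that j \<delta> by simp
          show "norm (\<zeta> k - \<zeta> j) \<le> \<delta>1" if "j \<le> k" for k using \<zeta>j[OF that] \<delta> by simp
        qed
        then have "X n \<in> U'" using nbhd by blast
        moreover have "t (Suc n) - t n \<le> T + 1" using an \<delta> T(1) by (simp add: t_def)
        ultimately show ?thesis using step by (intro exI[of _ n]) auto
      qed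
      moreover have "\<forall>k. n0 \<le> k \<and> k < Suc n \<longrightarrow> norm (X k) \<le> R"
        using bd Xn by (auto simp: less_Suc_eq)
      ultimately show ?case by blast
    qed
    have bd: "norm (X k) \<le> R" if "n0 \<le> k" for k using Q[of "Suc k"] that by auto
    have "\<exists>N. \<forall>n\<ge>N. X n \<in> eps_nbhd \<epsilon> A" if \<epsilon>: "0 < \<epsilon>" for \<epsilon>
    proof -
      obtain S where S: "0 < S" "\<And>S'. \<exists>\<delta>>0. tracked \<delta> (closure U') S S' (eps_nbhd \<epsilon> A)"
        using tracking[OF attr U'(3,4) \<epsilon>] by blast
      \<comment> \<open>The horizon adds a look-back of at most \<open>S + 1\<close> and at most
        \<open>T + 1\<close> from there to a visit.\<close>
      obtain e where e: "0 < e" "tracked e (closure U') S (S + T + 2) (eps_nbhd \<epsilon> A)"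
        using S(2) by blast
      obtain n2 where n2: "\<And>m. n2 \<le> m \<Longrightarrow> norm (\<zeta> m - \<zeta> n2) \<le> e / 2"
        using Cau[of "e / 2"] e(1) by auto
      have "\<forall>\<^sub>F k in sequentially. a k < min e 1" using order_tendstoD(2)[OF a(3), of "min e 1"] e(1) by simp
      then obtain n3 where n3: "\<And>k. n3 \<le> k \<Longrightarrow> a k < min e 1" by (auto simp: eventually_sequentially)
      define n1 where "n1 = max n0 (max n2 n3)"
      obtain N where N: "t n1 + (S + T + 2) \<le> t N"
        using partial_sums_unbounded[of a "t n1 + (S + T + 2)"] a by (auto simp: t_def less_imp_le)
      have "X n \<in> eps_nbhd \<epsilon> A" if n: "N \<le> n" for n
      proof -
        have tn: "t n1 + (S + T + 2) \<le> t n" using N strict_mono_leD[OF t_mono n] by simp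
        \<comment> \<open>Looks back from \<open>n\<close> by a time between \<open>S\<close> and
          \<open>S + 1\<close>; steps below 1 keep \<open>t i\<close> from passing
          \<open>t n - S\<close>.\<close>
        define i where "i = (LEAST k. t n - S - 1 \<le> t k)"
        have i1: "t n - S - 1 \<le> t i" unfolding i_def
          by (rule LeastI[of _ n]) (use S(1) in simp)
        have "t n1 < t i" using i1 tn T(1) by linarith
        then have "n1 < i" using t_mono by (simp add: strict_mono_less)
        then obtain i' where i': "i = Suc i'" "n1 \<le> i'" by (cases i) auto
        have "\<not> t n - S - 1 \<le> t i'" using i'(1) unfolding i_def by (intro not_less_Least) simp
        moreover have "t i = t i' + a i'" by (simp add: i'(1) t_def)
        moreover have "a i' < 1" using n3[of i'] i'(2) by (simp add: n1_def)
        ultimately have i2: "t i \<le> t n - S" by linarith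
        then have "t i \<le> t n" using S(1) by linarith
        then have "i \<le> n" using t_mono by (simp add: strict_mono_less_eq)
        have "n0 \<le> i" using \<open>n1 < i\<close> by (simp add: n1_def)
        then obtain j where j: "n0 \<le> j" "j \<le> i" "X j \<in> U'" "t i - t j \<le> T + 1" using Q[of i] by blast
        \<comment> \<open>The margin \<open>S + T + 2\<close> in the choice of \<open>N\<close> puts
          the visit \<open>j\<close> where steps and noise are already small.\<close>
        have "t n1 \<le> t j" using j(4) i1 tn by linarith
        then have "n1 \<le> j" using t_mono by (simp add: strict_mono_less_eq)
        show ?thesis
        proof (rule track[OF e(2) _ j(3)])
          show "j \<le> n" using j(2) \<open>i \<le> n\<close> by simp
          show "S \<le> t n - t j" using i2 strict_mono_leD[OF t_mono j(2)] by linarith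
          show "t n - t j \<le> S + T + 2" using j(4) i1 by linarith
          show "a k \<le> e" if "j \<le> k" for k using n3[of k] that \<open>n1 \<le> j\<close> by (simp add: n1_def)
          show "norm (\<zeta> k - \<zeta> j) \<le> e" if "j \<le> k" for k
            using osc[OF n2 n2, of k j] that \<open>n1 \<le> j\<close> by (simp add: n1_def)
          show "norm (X k) \<le> R" if "j \<le> k" for k using bd j(1) that by simp
        qed
      qed
      then show ?thesis by blast
    qed
    moreover have "infdist w A < \<epsilon>" if "w \<in> eps_nbhd \<epsilon> A" for w \<epsilon>
      using that infdist_le2[of _ A w] by (fastforce simp: eps_nbhd_def intro: le_less_trans[OF infdist_le])
    ultimately show "(\<lambda>n. infdist (X n) A) \<longlonglongrightarrow> 0"
      by (intro LIMSEQ_I) (metis real_norm_def diff_zero infdist_nonneg abs_of_nonneg)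
  qed (rule \<delta> R)+
qed

end

section \<open>A maximal Azuma inequality\<close>

text \<open>Made for martingale differences: the linear term integrates to zero and only the
  Gaussian factor remains. The core is \<open>exp x \<le> 1 + x + x\<^sup>2\<close> for
  \<open>\<bar>x\<bar> \<le> 1\<close>.\<close>

lemma exp_le_add_exp_square: "exp x \<le> x + exp (x\<^sup>2)" for x :: real
proof -
  consider "\<bar>x\<bar> \<le> 1" | "1 < x" | "x < - 1" by linarith
  then show ?thesis
  proof cases
    case 1
    have "exp x \<le> 1 + x + x\<^sup>2"
    proof (cases "0 \<le> x")
      case True
      then show ?thesis using exp_bound[of x] 1 by simp
    next
      case False
      \<comment> \<open>For negative \<open>x\<close> the Taylor polynomial bounds the reciprocal
        \<open>exp (- x)\<close> from below.\<close>
      then have "1 + (- x) + (- x)\<^sup>2 / 2 \<le> exp (- x)" by (intro exp_lower_Taylor_quadratic) simp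
      moreover have "0 \<le> 1 + x + x\<^sup>2" using 1 by simp
      ultimately have "(1 + x + x\<^sup>2) * (1 + (- x) + (- x)\<^sup>2 / 2) \<le> (1 + x + x\<^sup>2) * exp (- x)"
        by (rule mult_left_mono)
      moreover have "(1 + x + x\<^sup>2) * (1 + (- x) + (- x)\<^sup>2 / 2) = 1 + x\<^sup>2 * (1 - x + x\<^sup>2) / 2"
        by (simp add: power2_eq_square field_simps)
      moreover have "0 \<le> x\<^sup>2 * (1 - x + x\<^sup>2)" using False by (intro mult_nonneg_nonneg) auto
      ultimately have "1 \<le> (1 + x + x\<^sup>2) * exp (- x)" by simp
      then show ?thesis by (simp add: exp_minus field_simps)
    qed
    then show ?thesis using exp_ge_add_one_self[of "x\<^sup>2"] by linarith
  next
    case 2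
    then have "exp x \<le> exp (x\<^sup>2)" by (simp add: power2_eq_square)
    then show ?thesis using 2 by linarith
  next
    case 3
    have "(- x) * 1 \<le> (- x) * (- x)" using 3 by (intro mult_left_mono) auto
    then have "- x \<le> x\<^sup>2" by (simp add: power2_eq_square)
    moreover have "exp x \<le> 1" using 3 by simp
    ultimately show ?thesis using exp_ge_add_one_self[of "x\<^sup>2"] by linarith
  qed
qed

lemma subalgebra_measurable_mono:
  assumes "subalgebra P G" "subalgebra P H" "sets G \<subseteq> sets H" "f \<in> borel_measurable G"
  shows "f \<in> borel_measurable H"
  using assms measurable_mono[of borel borel G H] by (auto simp: subalgebra_def)

text \<open>\<open>d k\<close> is the increment from time \<open>k\<close> to \<open>k + 1\<close>,
  hence the \<open>Suc k\<close> in \<open>adapted\<close>.\<close>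

locale bounded_martingale_differences = prob_space P for P :: "'b measure" +
  fixes \<F> :: "nat \<Rightarrow> 'b measure" and d :: "nat \<Rightarrow> 'b \<Rightarrow> real" and c :: "nat \<Rightarrow> real"
  assumes subalg: "subalgebra P (\<F> k)"
    and mono: "k \<le> l \<Longrightarrow> sets (\<F> k) \<subseteq> sets (\<F> l)"
    and adapted: "d k \<in> borel_measurable (\<F> (Suc k))"
    and bound: "AE \<omega> in P. \<bar>d k \<omega>\<bar> \<le> c k"
    and cond_zero: "AE \<omega> in P. real_cond_exp P (\<F> k) (d k) \<omega> = 0"
begin

lemma measurable_mono_filtr: "f \<in> borel_measurable (\<F> k) \<Longrightarrow> k \<le> l \<Longrightarrow> f \<in> borel_measurable (\<F> l)"
  using subalgebra_measurable_mono[OF subalg subalg mono] .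

lemma measurable_filtr: "f \<in> borel_measurable (\<F> k) \<Longrightarrow> f \<in> borel_measurable P"
  by (rule measurable_from_subalg[OF subalg])

lemma orthogonal:
  assumes Y: "Y \<in> borel_measurable (\<F> k)" and i: "integrable P (\<lambda>\<omega>. Y \<omega> * d k \<omega>)"
  shows "(\<integral>\<omega>. Y \<omega> * d k \<omega> \<partial>P) = 0"
proof -
  interpret finite_measure_subalgebra P "\<F> k"
    by unfold_locales (rule subalg)
  have [measurable]: "Y \<in> borel_measurable P" "d k \<in> borel_measurable P"
    using measurable_filtr Y adapted by auto
  have "(\<integral>\<omega>. Y \<omega> * d k \<omega> \<partial>P) = (\<integral>\<omega>. Y \<omega> * real_cond_exp P (\<F> k) (d k) \<omega> \<partial>P)"
    by (rule real_cond_exp_intg(2)[symmetric, OF i Y]) simp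
  also have "\<dots> = (\<integral>\<omega>. 0 \<partial>P)"
    by (rule integral_cong_AE) (use cond_zero[of k] in auto)
  finally show ?thesis by simp
qed

text \<open>Apply \<open>exp_le_add_exp_square\<close> to \<open>g * d k\<close>; the linear term is
  orthogonal to the past. A predictable \<open>g\<close> in place of a constant permits sums that
  are switched off at a random time.\<close>

lemma exp_supermartingale_step:
  assumes Y: "Y \<in> borel_measurable (\<F> k)" "\<And>\<omega>. 0 \<le> Y \<omega>" "AE \<omega> in P. Y \<omega> \<le> B"
    and g: "g \<in> borel_measurable (\<F> k)" "\<And>\<omega>. \<bar>g \<omega>\<bar> \<le> \<theta>"
  shows "(\<integral>\<omega>. Y \<omega> * exp (g \<omega> * d k \<omega>) \<partial>P) \<le> exp (\<theta>\<^sup>2 * (c k)\<^sup>2) * (\<integral>\<omega>. Y \<omega> \<partial>P)"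
proof -
  have meas[measurable]: "Y \<in> borel_measurable P" "g \<in> borel_measurable P" "d k \<in> borel_measurable P"
    using measurable_filtr Y(1) g(1) adapted by auto
  have gd: "AE \<omega> in P. \<bar>g \<omega> * d k \<omega>\<bar> \<le> \<theta> * c k"
    using bound[of k]
  proof eventually_elim
    case (elim \<omega>)
    then show ?case unfolding abs_mult using g(2)[of \<omega>] by (intro mult_mono) auto
  qed
  have iY: "integrable P Y"
    by (rule integrable_const_bound[of _ B]) (use Y in auto)
  have iYgd: "integrable P (\<lambda>\<omega>. (Y \<omega> * g \<omega>) * d k \<omega>)"
  proof (rule integrable_const_bound[of _ "B * (\<theta> * c k)"])
    show "AE \<omega> in P. norm (Y \<omega> * g \<omega> * d k \<omega>) \<le> B * (\<theta> * c k)"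
      using gd Y(3)
    proof eventually_elim
      case (elim \<omega>)
      then have "\<bar>Y \<omega>\<bar> * \<bar>g \<omega> * d k \<omega>\<bar> \<le> B * (\<theta> * c k)" using Y(2)[of \<omega>] by (intro mult_mono) auto
      then show ?case by (simp add: abs_mult mult.assoc)
    qed
  qed simp
  have iYe: "integrable P (\<lambda>\<omega>. Y \<omega> * exp (g \<omega> * d k \<omega>))"
  proof (rule integrable_const_bound[of _ "B * exp (\<theta> * c k)"])
    show "AE \<omega> in P. norm (Y \<omega> * exp (g \<omega> * d k \<omega>)) \<le> B * exp (\<theta> * c k)"
      using gd Y(3)
    proof eventually_elim
      case (elim \<omega>)
      then have "\<bar>Y \<omega>\<bar> * exp (g \<omega> * d k \<omega>) \<le> B * exp (\<theta> * c k)" using Y(2)[of \<omega>] by (intro mult_mono) auto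
      then show ?case by (simp add: abs_mult)
    qed
  qed simp
  have "(\<integral>\<omega>. Y \<omega> * exp (g \<omega> * d k \<omega>) \<partial>P) \<le> (\<integral>\<omega>. (Y \<omega> * g \<omega>) * d k \<omega> + exp (\<theta>\<^sup>2 * (c k)\<^sup>2) * Y \<omega> \<partial>P)"
  proof (rule integral_mono_AE)
    show "AE \<omega> in P. Y \<omega> * exp (g \<omega> * d k \<omega>) \<le> (Y \<omega> * g \<omega>) * d k \<omega> + exp (\<theta>\<^sup>2 * (c k)\<^sup>2) * Y \<omega>"
      using gd
    proof eventually_elim
      case (elim \<omega>)
      have "(g \<omega> * d k \<omega>)\<^sup>2 \<le> (\<theta> * c k)\<^sup>2" using elim by (rule abs_le_square_iff[THEN iffD1, OF order_trans]) simp
      then have "exp (g \<omega> * d k \<omega>) \<le> g \<omega> * d k \<omega> + exp (\<theta>\<^sup>2 * (c k)\<^sup>2)"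
        using exp_le_add_exp_square[of "g \<omega> * d k \<omega>"] by (smt (verit) exp_le_cancel_iff power_mult_distrib)
      from mult_left_mono[OF this Y(2)[of \<omega>]] show ?case by (simp add: algebra_simps)
    qed
  qed (intro iYe Bochner_Integration.integrable_add iYgd integrable_mult_right iY)+
  also have "\<dots> = (\<integral>\<omega>. (Y \<omega> * g \<omega>) * d k \<omega> \<partial>P) + exp (\<theta>\<^sup>2 * (c k)\<^sup>2) * (\<integral>\<omega>. Y \<omega> \<partial>P)"
    using iYgd iY by simp
  also have "(\<integral>\<omega>. (Y \<omega> * g \<omega>) * d k \<omega> \<partial>P) = 0"
    by (intro orthogonal iYgd borel_measurable_times Y(1) g(1))
  finally show ?thesis by simp
qed

text \<open>\<open>g\<close> switches the sum off once it reaches \<open>\<alpha>\<close>, so the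
  stopped sum \<open>S'\<close> retains the crossing and a Markov bound at time \<open>m\<close>
  covers all earlier times. Starting from the indicator of \<open>E\<close>, an event of the past,
  produces the factor \<open>measure P E\<close>.\<close>

lemma maximal_inequality:
  assumes E: "E \<in> sets (\<F> n0)" and V: "0 < V" "\<And>m. (\<Sum>k=n0..<m. (c k)\<^sup>2) \<le> V" and \<alpha>: "0 < \<alpha>"
  shows "measure P {\<omega>\<in>E. \<exists>m\<ge>n0. \<alpha> \<le> (\<Sum>k=n0..<m. d k \<omega>)} \<le> exp (- (\<alpha>\<^sup>2 / (4 * V))) * measure P E"
proof -
  \<comment> \<open>Minimises the final exponent
    \<open>- \<theta> * \<alpha> + \<theta>\<^sup>2 * V\<close>.\<close>
  define \<theta> where "\<theta> = \<alpha> / (2 * V)"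
  have \<theta>: "0 < \<theta>" using \<alpha> V by (simp add: \<theta>_def)
  define S where "S m \<omega> = (\<Sum>k=n0..<m. d k \<omega>)" for m \<omega>
  define g where "g k \<omega> = (if \<forall>j\<in>{n0..k}. S j \<omega> < \<alpha> then 1 else 0 :: real)" for k \<omega>
  define S' where "S' m \<omega> = (\<Sum>k=n0..<m. g k \<omega> * d k \<omega>)" for m \<omega>
  have EP[measurable]: "E \<in> sets P" using E subalg[of n0] by (auto simp: subalgebra_def)
  have S_meas: "S m \<in> borel_measurable (\<F> m)" for m
    unfolding S_def by (intro borel_measurable_sum measurable_mono_filtr[OF adapted]) auto
  have g_meas: "g k \<in> borel_measurable (\<F> k)" for k
  proof -
    have [measurable]: "S j \<in> borel_measurable (\<F> k)" if "j \<in> {n0..k}" for j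
      using that by (intro measurable_mono_filtr[OF S_meas]) auto
    have "Measurable.pred (\<F> k) (\<lambda>\<omega>. \<forall>j\<in>{n0..k}. S j \<omega> < \<alpha>)"
      by (intro pred_intros_finite) measurable
    then show ?thesis unfolding g_def by measurable
  qed
  have g_bd: "\<bar>\<theta> * g k \<omega>\<bar> \<le> \<theta>" for k \<omega> using \<theta> by (simp add: g_def)
  have S'_meas: "S' m \<in> borel_measurable (\<F> m)" for m
    unfolding S'_def
    by (intro borel_measurable_sum borel_measurable_times measurable_mono_filtr[OF adapted] measurable_mono_filtr[OF g_meas]) auto
  have S_measP[measurable]: "S m \<in> borel_measurable P" "S' m \<in> borel_measurable P" "g m \<in> borel_measurable P" for m
    using measurable_filtr S_meas S'_meas g_meas by blast+
  have stop: "((\<forall>j\<in>{n0..m}. S j \<omega> < \<alpha>) \<longrightarrow> S' m \<omega> = S m \<omega>) \<and> ((\<exists>j\<in>{n0..m}. \<alpha> \<le> S j \<omega>) \<longrightarrow> \<alpha> \<le> S' m \<omega>)"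
    if "n0 \<le> m" for m \<omega>
    using that
  proof (induction m rule: dec_induct)
    case base
    then show ?case using \<alpha> by (simp add: S_def S'_def)
  next
    case (step m)
    have Suc: "{n0..Suc m} = insert (Suc m) {n0..m}" using step by auto
    have S1: "S (Suc m) \<omega> = S m \<omega> + d m \<omega>" "S' (Suc m) \<omega> = S' m \<omega> + g m \<omega> * d m \<omega>"
      using step by (simp_all add: S_def S'_def)
    show ?case
    proof (cases "\<forall>j\<in>{n0..m}. S j \<omega> < \<alpha>")
      case True
      then have "g m \<omega> = 1" by (simp add: g_def)
      then have "S' (Suc m) \<omega> = S (Suc m) \<omega>" using step True by (simp add: S1)
      then show ?thesis using True Suc by (auto simp: not_le)
    next
      case False
      then have "g m \<omega> = 0" by (simp add: g_def)
      moreover have "\<alpha> \<le> S' m \<omega>" using False step by (auto simp: not_less)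
      ultimately show ?thesis using False Suc by (auto simp: S1)
    qed
  qed
  define Y where "Y m \<omega> = indicator E \<omega> * exp (\<theta> * S' m \<omega>)" for m \<omega>
  have Y_meas: "Y m \<in> borel_measurable (\<F> m)" if "n0 \<le> m" for m
  proof -
    have [measurable]: "E \<in> sets (\<F> m)" using E mono[OF that] by auto
    note S'_meas[measurable]
    show ?thesis unfolding Y_def by measurable
  qed
  have Y_nn: "0 \<le> Y m \<omega>" for m \<omega> by (simp add: Y_def)
  have Y_bd: "AE \<omega> in P. Y m \<omega> \<le> exp (\<theta> * (\<Sum>k=n0..<m. c k))" for m
  proof -
    have "AE \<omega> in P. \<forall>k. \<bar>d k \<omega>\<bar> \<le> c k" using bound by (simp add: AE_all_countable)
    then show ?thesis
    proof eventually_elim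
      case (elim \<omega>)
      have "g k \<omega> * d k \<omega> \<le> c k" for k
        using elim[rule_format, of k] by (auto simp: g_def)
      then have "S' m \<omega> \<le> (\<Sum>k=n0..<m. c k)" unfolding S'_def by (intro sum_mono)
      then have "exp (\<theta> * S' m \<omega>) \<le> exp (\<theta> * (\<Sum>k=n0..<m. c k))" using \<theta> by simp
      then show ?case by (auto simp: Y_def indicator_def)
    qed
  qed
  have Y_int: "integrable P (Y m)" if "n0 \<le> m" for m
    by (rule integrable_const_bound[OF _ measurable_filtr[OF Y_meas[OF that]]])
       (use Y_bd[of m] Y_nn in auto)
  have EY: "(\<integral>\<omega>. Y m \<omega> \<partial>P) \<le> exp (\<theta>\<^sup>2 * (\<Sum>k=n0..<m. (c k)\<^sup>2)) * measure P E" if "n0 \<le> m" for m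
    using that
  proof (induction m rule: dec_induct)
    case base
    then show ?case by (simp add: Y_def S'_def)
  next
    case (step m)
    have "(\<integral>\<omega>. Y (Suc m) \<omega> \<partial>P) = (\<integral>\<omega>. Y m \<omega> * exp ((\<theta> * g m \<omega>) * d m \<omega>) \<partial>P)"
      using step by (intro Bochner_Integration.integral_cong) (auto simp: Y_def S'_def algebra_simps exp_add)
    also have "\<dots> \<le> exp (\<theta>\<^sup>2 * (c m)\<^sup>2) * (\<integral>\<omega>. Y m \<omega> \<partial>P)"
      by (rule exp_supermartingale_step[OF Y_meas Y_nn Y_bd])
         (use step \<theta> in \<open>auto simp: g_bd intro!: borel_measurable_times g_meas\<close>)
    also have "\<dots> \<le> exp (\<theta>\<^sup>2 * (c m)\<^sup>2) * (exp (\<theta>\<^sup>2 * (\<Sum>k=n0..<m. (c k)\<^sup>2)) * measure P E)"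
      using step by (intro mult_left_mono) auto
    also have "\<dots> = exp (\<theta>\<^sup>2 * (\<Sum>k=n0..<Suc m. (c k)\<^sup>2)) * measure P E"
      using step by (simp add: algebra_simps flip: exp_add)
    finally show ?case .
  qed
  define B where "B m = {\<omega>\<in>E. \<exists>j\<in>{n0..m}. \<alpha> \<le> S j \<omega>}" for m
  have B_meas[measurable]: "B m \<in> sets P" for m unfolding B_def by measurable
  have B_le: "measure P (B m) \<le> exp (- (\<alpha>\<^sup>2 / (4 * V))) * measure P E" if m: "n0 \<le> m" for m
  proof -
    have "measure P (B m) = (\<integral>\<omega>. indicator (B m) \<omega> \<partial>P)" by simp
    also have "\<dots> \<le> (\<integral>\<omega>. exp (- \<theta> * \<alpha>) * Y m \<omega> \<partial>P)"
    proof (rule integral_mono)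
      fix \<omega>
      show "indicator (B m) \<omega> \<le> exp (- \<theta> * \<alpha>) * Y m \<omega>"
      proof (cases "\<omega> \<in> B m")
        case True
        then have "\<alpha> \<le> S' m \<omega>" "\<omega> \<in> E" using stop[OF m, of \<omega>] by (auto simp: B_def)
        then have "1 \<le> exp (- \<theta> * \<alpha> + \<theta> * S' m \<omega>)" using \<theta> by simp
        then show ?thesis using True \<open>\<omega> \<in> E\<close> by (simp only: Y_def exp_add) simp
      qed (simp add: Y_nn)
    qed (use Y_int[OF m] in \<open>auto intro!: integrable_real_indicator simp: emeasure_eq_measure\<close>)
    also have "\<dots> = exp (- \<theta> * \<alpha>) * (\<integral>\<omega>. Y m \<omega> \<partial>P)" by simp
    also have "\<dots> \<le> exp (- \<theta> * \<alpha>) * (exp (\<theta>\<^sup>2 * V) * measure P E)"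
      using V(2)[of m] by (intro mult_left_mono order_trans[OF EY[OF m]] mult_right_mono) (auto intro!: mult_left_mono)
    also have "\<dots> = exp (- \<theta> * \<alpha> + \<theta>\<^sup>2 * V) * measure P E" by (simp only: exp_add mult.assoc)
    also have "- \<theta> * \<alpha> + \<theta>\<^sup>2 * V = - (\<alpha>\<^sup>2 / (4 * V))"
      using V(1) by (simp add: \<theta>_def power2_eq_square field_simps)
    finally show ?thesis .
  qed
  have inc: "incseq B" by (auto simp: incseq_def B_def)
  have "(\<lambda>m. measure P (B m)) \<longlonglongrightarrow> measure P (\<Union>m. B m)"
    by (rule finite_Lim_measure_incseq[OF _ inc]) auto
  then have "measure P (\<Union>m. B m) \<le> exp (- (\<alpha>\<^sup>2 / (4 * V))) * measure P E"
    by (rule LIMSEQ_le_const2) (use B_le in blast)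
  moreover have "(\<Union>m. B m) = {\<omega>\<in>E. \<exists>m\<ge>n0. \<alpha> \<le> (\<Sum>k=n0..<m. d k \<omega>)}"
    unfolding B_def S_def by (blast intro: atLeastAtMost_iff[THEN iffD2] order_refl dest: atLeastAtMost_iff[THEN iffD1])
  ultimately show ?thesis by simp
qed


lemma uminus_bounded_martingale_differences:
  "bounded_martingale_differences P \<F> (\<lambda>k \<omega>. - d k \<omega>) c"
proof unfold_locales
  fix k
  interpret finite_measure_subalgebra P "\<F> k"
    by unfold_locales (rule subalg)
  have "integrable P (d k)"
    by (rule integrable_const_bound[OF _ measurable_filtr[OF adapted]]) (use bound[of k] in auto)
  from real_cond_exp_cmult[OF this, of "-1"]
  show "AE \<omega> in P. real_cond_exp P (\<F> k) (\<lambda>\<omega>. - d k \<omega>) \<omega> = 0"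
    using cond_zero[of k] by auto
qed (use subalg mono adapted bound in auto)

end

section \<open>Vector-valued martingale differences\<close>

lemma norm_less_of_components:
  fixes x :: "'a::euclidean_space"
  assumes "\<And>b. b \<in> Basis \<Longrightarrow> \<bar>x \<bullet> b\<bar> < \<delta> / DIM('a)"
  shows "norm x < \<delta>"
proof -
  have "(\<Sum>b\<in>Basis. \<bar>x \<bullet> b\<bar>) < (\<Sum>b\<in>(Basis :: 'a set). \<delta> / DIM('a))"
    using assms by (intro sum_strict_mono) auto
  also have "\<dots> = \<delta>" by simp
  finally show ?thesis using norm_le_l1[of x] by linarith
qed

text \<open>If the norm reaches \<open>\<delta>\<close>, some signed coordinate reaches
  \<open>\<delta> / DIM('a)\<close>. The union bound over the signed coordinates is the origin of
  the factor \<open>2 * DIM('a)\<close>.\<close>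

lemma vector_maximal_inequality:
  fixes D :: "nat \<Rightarrow> 'b \<Rightarrow> 'a::euclidean_space"
  assumes D: "\<And>b. b \<in> Basis \<Longrightarrow> bounded_martingale_differences P \<F> (\<lambda>k \<omega>. D k \<omega> \<bullet> b) c"
    and E: "E \<in> sets (\<F> n0)" and V: "0 < V" "\<And>m. (\<Sum>k=n0..<m. (c k)\<^sup>2) \<le> V" and \<delta>: "0 < \<delta>"
  shows "{\<omega>\<in>E. \<exists>m\<ge>n0. \<delta> \<le> norm (\<Sum>k=n0..<m. D k \<omega>)} \<in> sets P"
    and "measure P {\<omega>\<in>E. \<exists>m\<ge>n0. \<delta> \<le> norm (\<Sum>k=n0..<m. D k \<omega>)}
      \<le> 2 * real DIM('a) * exp (- ((\<delta> / DIM('a))\<^sup>2 / (4 * V))) * measure P E"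
proof -
  obtain b0 :: 'a where "b0 \<in> Basis" using nonempty_Basis by blast
  then interpret b0: bounded_martingale_differences P \<F> "\<lambda>k \<omega>. D k \<omega> \<bullet> b0" c by (rule D)
  have EP[measurable]: "E \<in> sets P" using E b0.subalg[of n0] by (auto simp: subalgebra_def)
  have Db: "(\<lambda>\<omega>. D k \<omega> \<bullet> b) \<in> borel_measurable P" if "b \<in> Basis" for b k
  proof -
    interpret bounded_martingale_differences P \<F> "\<lambda>k \<omega>. D k \<omega> \<bullet> b" c by (rule D[OF that])
    show ?thesis by (rule measurable_filtr[OF adapted])
  qed
  have [measurable]: "D k \<in> borel_measurable P" for k
    using Db by (subst borel_measurable_euclidean_space) blast
  show "{\<omega>\<in>E. \<exists>m\<ge>n0. \<delta> \<le> norm (\<Sum>k=n0..<m. D k \<omega>)} \<in> sets P" by measurable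
  define \<alpha> where "\<alpha> = \<delta> / DIM('a)"
  have \<alpha>: "0 < \<alpha>" using \<delta> by (simp add: \<alpha>_def)
  define A where "A i = {\<omega>\<in>E. \<exists>m\<ge>n0. \<alpha> \<le> (\<Sum>k=n0..<m. snd i * (D k \<omega> \<bullet> fst i))}" for i :: "'a \<times> real"
  let ?I = "(Basis :: 'a set) \<times> {1, -1 :: real}"
  have A_meas: "A i \<in> sets P" for i unfolding A_def by measurable
  have A_le: "measure P (A i) \<le> exp (- (\<alpha>\<^sup>2 / (4 * V))) * measure P E" if iI: "i \<in> ?I" for i
  proof -
    obtain b s where i: "i = (b, s)" "b \<in> Basis" "s = 1 \<or> s = -1" using iI by (cases i) auto
    interpret bounded_martingale_differences P \<F> "\<lambda>k \<omega>. D k \<omega> \<bullet> b" c by (rule D[OF i(2)])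
    interpret m: bounded_martingale_differences P \<F> "\<lambda>k \<omega>. - (D k \<omega> \<bullet> b)" c
      by (rule uminus_bounded_martingale_differences)
    show ?thesis
      using i(3) maximal_inequality[OF E V \<alpha>] m.maximal_inequality[OF E V \<alpha>] by (auto simp: A_def i(1))
  qed
  have "{\<omega>\<in>E. \<exists>m\<ge>n0. \<delta> \<le> norm (\<Sum>k=n0..<m. D k \<omega>)} \<subseteq> (\<Union>i\<in>?I. A i)"
  proof
    fix \<omega> assume "\<omega> \<in> {\<omega>\<in>E. \<exists>m\<ge>n0. \<delta> \<le> norm (\<Sum>k=n0..<m. D k \<omega>)}"
    then obtain m where m: "\<omega> \<in> E" "n0 \<le> m" "\<delta> \<le> norm (\<Sum>k=n0..<m. D k \<omega>)" by blast
    then obtain b where b: "b \<in> Basis" "\<alpha> \<le> \<bar>(\<Sum>k=n0..<m. D k \<omega>) \<bullet> b\<bar>"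
      using norm_less_of_components[of "\<Sum>k=n0..<m. D k \<omega>" \<delta>] by (force simp: \<alpha>_def)
    then have "\<alpha> \<le> (\<Sum>k=n0..<m. 1 * (D k \<omega> \<bullet> b)) \<or> \<alpha> \<le> (\<Sum>k=n0..<m. -1 * (D k \<omega> \<bullet> b))"
      unfolding sum_distrib_left[symmetric] by (auto simp: inner_sum_left)
    then have "\<omega> \<in> A (b, 1) \<or> \<omega> \<in> A (b, -1)" using m by (auto simp: A_def)
    then show "\<omega> \<in> (\<Union>i\<in>?I. A i)" using b by auto
  qed
  then have "measure P {\<omega>\<in>E. \<exists>m\<ge>n0. \<delta> \<le> norm (\<Sum>k=n0..<m. D k \<omega>)} \<le> measure P (\<Union>i\<in>?I. A i)"
    using A_meas by (intro b0.finite_measure_mono) auto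
  also have "\<dots> \<le> (\<Sum>i\<in>?I. measure P (A i))"
    using A_meas by (intro b0.finite_measure_subadditive_finite) auto
  also have "\<dots> \<le> (\<Sum>i\<in>?I. exp (- (\<alpha>\<^sup>2 / (4 * V))) * measure P E)"
    using A_le by (rule sum_mono)
  also have "\<dots> = 2 * real DIM('a) * exp (- (\<alpha>\<^sup>2 / (4 * V))) * measure P E"
    by (simp add: card_cartesian_product)
  finally show "measure P {\<omega>\<in>E. \<exists>m\<ge>n0. \<delta> \<le> norm (\<Sum>k=n0..<m. D k \<omega>)}
      \<le> 2 * real DIM('a) * exp (- ((\<delta> / DIM('a))\<^sup>2 / (4 * V))) * measure P E"
    unfolding \<alpha>_def .
qed

section \<open>The natural filtration and the truncated noise\<close>

lemma space_nat_filtr [simp]: "space (nat_filtr P X M n) = space P"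
  unfolding nat_filtr_def by (rule space_measure_of) auto

lemma sets_nat_filtr:
  "sets (nat_filtr P X M n) = sigma_sets (space P)
     ({X m -` B \<inter> space P | m B. m \<le> n \<and> B \<in> sets borel} \<union>
      {M m -` B \<inter> space P | m B. 1 \<le> m \<and> m \<le> n \<and> B \<in> sets borel})"
  unfolding nat_filtr_def by (rule sets_measure_of) auto

lemma sets_nat_filtr_mono: "k \<le> l \<Longrightarrow> sets (nat_filtr P X M k) \<subseteq> sets (nat_filtr P X M l)"
  unfolding sets_nat_filtr by (intro sigma_sets_mono' Un_mono) (blast intro: order_trans)+

lemma nat_filtr_measurable:
  fixes X M :: "nat \<Rightarrow> 'b \<Rightarrow> 'a::topological_space"
  shows "m \<le> n \<Longrightarrow> X m \<in> borel_measurable (nat_filtr P X M n)"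
    and "1 \<le> m \<Longrightarrow> m \<le> n \<Longrightarrow> M m \<in> borel_measurable (nat_filtr P X M n)"
  by (intro measurableI; auto simp: sets_nat_filtr intro!: sigma_sets.Basic)+

lemma subalgebra_nat_filtr:
  fixes X M :: "nat \<Rightarrow> 'b \<Rightarrow> 'a::topological_space"
  assumes "\<And>n. X n \<in> borel_measurable P" "\<And>n. 1 \<le> n \<Longrightarrow> M n \<in> borel_measurable P"
  shows "subalgebra P (nat_filtr P X M n)"
  unfolding subalgebra_def sets_nat_filtr
  using assms by (auto intro!: sets.sigma_sets_subset measurable_sets)

text \<open>Whether \<open>X k\<close> lies in the ball is known at time \<open>k\<close>, so the
  truncation factor comes out of the conditional expectation; inside the ball the noise bound
  becomes the constant \<open>L * (1 + R)\<close>.\<close>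

lemma truncated_noise_martingale:
  fixes X M :: "nat \<Rightarrow> 'b \<Rightarrow> 'a::euclidean_space"
  assumes P: "prob_space P"
    and X: "\<And>n. X n \<in> borel_measurable P" and M: "\<And>n. n \<ge> 1 \<Longrightarrow> M n \<in> borel_measurable P"
    and md: "mart_diff P X M"
    and bd: "\<And>n. AE \<omega> in P. norm (M (Suc n) \<omega>) \<le> L * (1 + norm (X n \<omega>))"
    and L: "0 \<le> L" and a: "\<And>n. 0 \<le> a n" and R: "0 \<le> R" and b: "b \<in> Basis"
  shows "bounded_martingale_differences P (nat_filtr P X M)
    (\<lambda>k \<omega>. (if norm (X k \<omega>) \<le> R then a k *\<^sub>R M (Suc k) \<omega> else 0) \<bullet> b) (\<lambda>k. a k * (L * (1 + R)))"
proof -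
  interpret prob_space P by (rule P)
  have sub: "subalgebra P (nat_filtr P X M n)" for n
    by (rule subalgebra_nat_filtr) (use X M in auto)
  show ?thesis
  proof unfold_locales
    fix k
    interpret S: finite_measure_subalgebra P "nat_filtr P X M k"
      by unfold_locales (rule sub)
    let ?d = "\<lambda>\<omega>. (if norm (X k \<omega>) \<le> R then a k *\<^sub>R M (Suc k) \<omega> else 0) \<bullet> b"
    have [measurable]: "X k \<in> borel_measurable (nat_filtr P X M (Suc k))"
      "M (Suc k) \<in> borel_measurable (nat_filtr P X M (Suc k))"
      by (intro nat_filtr_measurable; simp)+
    show "?d \<in> borel_measurable (nat_filtr P X M (Suc k))" by measurable
    from measurable_from_subalg[OF sub this] have dP: "?d \<in> borel_measurable P" .
    show bound: "AE \<omega> in P. \<bar>?d \<omega>\<bar> \<le> a k * (L * (1 + R))"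
      using bd[of k]
    proof eventually_elim
      case (elim \<omega>)
      show ?case
      proof (cases "norm (X k \<omega>) \<le> R")
        case True
        have "\<bar>M (Suc k) \<omega> \<bullet> b\<bar> \<le> norm (M (Suc k) \<omega>)" by (rule Basis_le_norm[OF b])
        also have "\<dots> \<le> L * (1 + norm (X k \<omega>))" by (rule elim)
        also have "\<dots> \<le> L * (1 + R)" using True L by (intro mult_left_mono) auto
        finally have "a k * \<bar>M (Suc k) \<omega> \<bullet> b\<bar> \<le> a k * (L * (1 + R))" using a by (intro mult_left_mono)
        then show ?thesis using True a[of k] by (simp add: abs_mult)
      next
        case False
        then show ?thesis using a[of k] L R by simp
      qed
    qed
    let ?g = "\<lambda>\<omega>. if norm (X k \<omega>) \<le> R then a k else 0"
    have "X k \<in> borel_measurable (nat_filtr P X M k)" by (rule nat_filtr_measurable) simp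
    then have g: "?g \<in> borel_measurable (nat_filtr P X M k)" by measurable
    have d_eq: "?d = (\<lambda>\<omega>. ?g \<omega> * (M (Suc k) \<omega> \<bullet> b))" by auto
    have "integrable P ?d"
      by (rule integrable_const_bound[OF _ dP]) (use bound in auto)
    then have "AE \<omega> in P. real_cond_exp P (nat_filtr P X M k) ?d \<omega> =
        ?g \<omega> * real_cond_exp P (nat_filtr P X M k) (\<lambda>\<omega>. M (Suc k) \<omega> \<bullet> b) \<omega>"
      unfolding d_eq using M[of "Suc k"] by (intro S.real_cond_exp_mult g) auto
    moreover have "AE \<omega> in P. real_cond_exp P (nat_filtr P X M k) (\<lambda>\<omega>. M (Suc k) \<omega> \<bullet> b) \<omega> = 0"
      using md b by (auto simp: mart_diff_def)
    ultimately show "AE \<omega> in P. real_cond_exp P (nat_filtr P X M k) ?d \<omega> = 0" by auto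
  next
    show "subalgebra P (nat_filtr P X M k)" for k by (rule sub)
    show "sets (nat_filtr P X M k) \<subseteq> sets (nat_filtr P X M l)" if "k \<le> l" for k l
      using that by (rule sets_nat_filtr_mono)
  qed
qed

section \<open>Convergence to the attracting set\<close>

lemma suminf_tail_tendsto_zero:
  fixes f :: "nat \<Rightarrow> real"
  assumes "summable f"
  shows "(\<lambda>n. \<Sum>k. f (k + n)) \<longlonglongrightarrow> 0"
proof -
  have "(\<lambda>n. suminf f - sum f {..<n}) \<longlonglongrightarrow> suminf f - suminf f"
    by (intro tendsto_intros summable_LIMSEQ assms)
  then show ?thesis using assms by (simp add: suminf_minus_initial_segment)
qed

lemma suminf_tail_bounds:
  fixes f :: "nat \<Rightarrow> real"
  assumes f: "summable f" "\<And>k. 0 < f k"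
  shows suminf_tail_pos: "0 < (\<Sum>k. f (k + n))"
    and sum_le_suminf_tail: "(\<Sum>k=n..<m. f k) \<le> (\<Sum>k. f (k + n))"
proof -
  have s: "summable (\<lambda>k. f (k + n))" using f(1) by (simp add: summable_iff_shift)
  show "0 < (\<Sum>k. f (k + n))" by (rule suminf_pos[OF s]) (rule f(2))
  have "(\<Sum>k=n..<m. f k) = (\<Sum>k<m - n. f (k + n))"
    by (rule sum.reindex_bij_witness[of _ "\<lambda>k. k + n" "\<lambda>k. k - n"]) auto
  also have "\<dots> \<le> (\<Sum>k. f (k + n))"
    by (rule sum_le_suminf[OF s]) (use f(2) in \<open>auto simp: less_imp_le\<close>)
  finally show "(\<Sum>k=n..<m. f k) \<le> (\<Sum>k. f (k + n))" .
qed

text \<open>A path that is bad from every \<open>n\<close> on lies in each single bad event, and the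
  probability of these tends to 0 with the tail \<open>V n\<close>.\<close>

lemma AE_partial_sums_Cauchy:
  fixes D :: "nat \<Rightarrow> 'b \<Rightarrow> 'a::euclidean_space"
  assumes D: "\<And>b. b \<in> Basis \<Longrightarrow> bounded_martingale_differences P \<F> (\<lambda>k \<omega>. D k \<omega> \<bullet> b) c"
    and c: "summable (\<lambda>k. (c k)\<^sup>2)" "\<And>k. 0 < c k" and \<delta>: "0 < \<delta>"
  shows "AE \<omega> in P. \<exists>n. \<forall>m\<ge>n. norm (\<Sum>k=n..<m. D k \<omega>) \<le> \<delta>"
proof -
  obtain b0 :: 'a where "b0 \<in> Basis" using nonempty_Basis by blast
  then interpret b0: bounded_martingale_differences P \<F> "\<lambda>k \<omega>. D k \<omega> \<bullet> b0" c by (rule D)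
  define V where "V n = (\<Sum>k. (c (k + n))\<^sup>2)" for n
  have V: "0 < V n" "\<And>m. (\<Sum>k=n..<m. (c k)\<^sup>2) \<le> V n" for n
    unfolding V_def using c(2)
    by (intro suminf_tail_bounds[OF c(1)] zero_less_power; simp)+
  define Bad where "Bad n = {\<omega>\<in>space P. \<exists>m\<ge>n. \<delta> \<le> norm (\<Sum>k=n..<m. D k \<omega>)}" for n
  define q where "q = (\<delta> / DIM('a))\<^sup>2 / 4"
  have q: "0 < q" using \<delta> by (simp add: q_def)
  have sp: "space P \<in> sets (\<F> n)" for n
    using sets.top[of "\<F> n"] b0.subalg[of n] unfolding subalgebra_def by metis
  have Bad: "Bad n \<in> sets P" for n
    unfolding Bad_def by (rule vector_maximal_inequality(1)[OF D sp V \<delta>])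
  \<comment> \<open>The exponential is weakened to a bound linear in \<open>V n\<close>, whose limit
    is immediate.\<close>
  have le: "measure P (Bad n) \<le> 2 * real DIM('a) * (V n / q)" for n
  proof -
    have "measure P (Bad n) \<le> 2 * real DIM('a) * exp (- (q / V n)) * measure P (space P)"
      using vector_maximal_inequality(2)[OF D sp V \<delta>, of n] unfolding Bad_def q_def by simp
    also have "\<dots> = 2 * real DIM('a) * exp (- (q / V n))" by (simp add: b0.prob_space)
    also have "\<dots> \<le> 2 * real DIM('a) * (V n / q)"
    proof (rule mult_left_mono)
      have "q / V n \<le> exp (q / V n)" using exp_ge_add_one_self[of "q / V n"] by linarith
      then have "inverse (exp (q / V n)) \<le> inverse (q / V n)"
        using q V(1)[of n] by (intro le_imp_inverse_le) auto
      then show "exp (- (q / V n)) \<le> V n / q" by (simp add: exp_minus)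
    qed simp
    finally show ?thesis .
  qed
  have Inter: "(\<Inter>n. Bad n) \<in> sets P" using Bad by auto
  have "measure P (\<Inter>n. Bad n) \<le> 0"
  proof (rule LIMSEQ_le_const)
    show "(\<lambda>n. 2 * real DIM('a) * (V n / q)) \<longlonglongrightarrow> 0"
      using tendsto_mult[OF tendsto_const tendsto_divide[OF suminf_tail_tendsto_zero[OF c(1)] tendsto_const], of q "2 * real DIM('a)"] q
      by (simp add: V_def)
    show "\<exists>N. \<forall>n\<ge>N. measure P (\<Inter>n. Bad n) \<le> 2 * real DIM('a) * (V n / q)"
      using Bad Inter by (intro exI[of _ 0] allI impI order_trans[OF b0.finite_measure_mono le]) auto
  qed
  then have "emeasure P (\<Inter>n. Bad n) = 0"
    by (simp add: b0.emeasure_eq_measure measure_le_0_iff)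
  then have "AE \<omega> in P. \<omega> \<notin> (\<Inter>n. Bad n)"
    using Inter by (intro AE_not_in) (auto simp: null_sets_def)
  with AE_space show ?thesis
  proof eventually_elim
    case (elim \<omega>)
    then obtain n where "\<omega> \<notin> Bad n" by blast
    with elim(1) have "\<not> \<delta> \<le> norm (\<Sum>k=n..<m. D k \<omega>)" if "n \<le> m" for m
      using that unfolding Bad_def by blast
    then show ?case by (intro exI[of _ n]) (simp add: not_le less_imp_le)
  qed
qed

theorem theorem2:
  fixes P :: "'b measure"
    and X M :: "nat \<Rightarrow> 'b \<Rightarrow> 'a::euclidean_space"
    and F :: "'a \<Rightarrow> 'a set"
    and a :: "nat \<Rightarrow> real"
    and K1 K2 :: real
    and A U U' :: "'a set"
  assumes prob: "prob_space P"
    and X_rv: "\<And>n. X n \<in> borel_measurable P"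
    and M_rv: "\<And>n. n \<ge> 1 \<Longrightarrow> M n \<in> borel_measurable P"
    and recursion: "\<And>n \<omega>. \<omega> \<in> space P \<Longrightarrow>
          X (Suc n) \<omega> - X n \<omega> - a n *\<^sub>R M (Suc n) \<omega> \<in> (\<lambda>y. a n *\<^sub>R y) ` F (X n \<omega>)"
    (* (A1) *)
    and F_nonempty: "\<And>x. F x \<noteq> {}"
    and F_convex: "\<And>x. convex (F x)"
    and F_compact: "\<And>x. compact (F x)"
    and K1_pos: "K1 > 0"
    and F_growth: "\<And>x. (SUP y\<in>F x. norm y) \<le> K1 * (1 + norm x)"
    and F_closed_graph: "\<And>xs ys x y. xs \<longlonglongrightarrow> x \<Longrightarrow> (\<And>n. ys n \<in> F (xs n)) \<Longrightarrow> ys \<longlonglongrightarrow> y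
          \<Longrightarrow> y \<in> F x"
    (* (A2) *)
    and a_pos: "\<And>n. a n > 0"
    and a_not_summable: "\<not> summable a"
    and a_sq_summable: "summable (\<lambda>n. (a n)\<^sup>2)"
    (* (A3) *)
    and M_mart_diff: "mart_diff P X M"
    and K2_pos: "K2 > 0"
    and M_bound: "\<And>n. AE \<omega> in P. norm (M (Suc n) \<omega>) \<le> K2 * (1 + norm (X n \<omega>))"
    (* (A4) *)
    and attracting: "attracting_set F A U"
    (* U' *)
    and U'_open: "open U'"
    and A_sub_U': "A \<subseteq> U'"
    and U'_compact: "compact (closure U')"
    and U'_sub_O: "closure U' \<subseteq> U"
  shows "\<exists>K'>0. \<exists>N0\<ge>(1::nat). \<forall>n0\<ge>N0. \<forall>E \<in> sets (nat_filtr P X M n0).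
           E \<subseteq> {\<omega> \<in> space P. X n0 \<omega> \<in> U'} \<longrightarrow> measure P E > 0 \<longrightarrow>
           measure P ({\<omega> \<in> space P. (\<lambda>n. infdist (X n \<omega>) A) \<longlonglongrightarrow> 0} \<inter> E) / measure P E
             \<ge> 1 - 2 * real DIM('a) * exp (- K' / (\<Sum>k. (a (k + n0))\<^sup>2))"
proof -
  interpret prob_space P by (rule prob)
  interpret marchaud F K1
  proof
    fix x v assume v: "v \<in> F x"
    \<comment> \<open>A real supremum controls the single elements only when the set is bounded
      above; compactness provides this.\<close>
    have "bdd_above (norm ` F x)"
      by (intro compact_imp_bounded[THEN bounded_imp_bdd_above] compact_continuous_image
          continuous_intros F_compact)
    then have "norm v \<le> (SUP y\<in>F x. norm y)" using v by (intro cSUP_upper)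
    also note F_growth[of x]
    finally show "norm v \<le> K1 * (1 + norm x)" .
  next
    show "v \<in> F x" if "xs \<longlonglongrightarrow> x" "\<And>n. vs n \<in> F (xs n)" "vs \<longlonglongrightarrow> v" for xs vs x v
      using that by (rule F_closed_graph)
  qed (rule F_nonempty F_convex F_compact K1_pos)+
  obtain R \<delta> where \<delta>: "0 < \<delta>" and R: "0 < R" and conv:
    "\<And>a X M \<zeta> n0.
      (\<And>k. 0 < a k) \<Longrightarrow> \<not> summable a \<Longrightarrow> a \<longlonglongrightarrow> 0 \<Longrightarrow>
      (\<And>k. \<exists>v\<in>F (X k). X (Suc k) = X k + a k *\<^sub>R v + a k *\<^sub>R M (Suc k)) \<Longrightarrow>
      (\<And>m. \<zeta> m = (\<Sum>k<m. if norm (X k) \<le> R then a k *\<^sub>R M (Suc k) else 0)) \<Longrightarrow>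
      X n0 \<in> U' \<Longrightarrow> (\<And>k. n0 \<le> k \<Longrightarrow> a k \<le> \<delta>) \<Longrightarrow>
      (\<And>m. n0 \<le> m \<Longrightarrow> norm (\<zeta> m - \<zeta> n0) \<le> \<delta>) \<Longrightarrow>
      (\<And>\<epsilon>. 0 < \<epsilon> \<Longrightarrow> \<exists>n. \<forall>m\<ge>n. norm (\<zeta> m - \<zeta> n) \<le> \<epsilon>) \<Longrightarrow>
      (\<lambda>n. infdist (X n) A) \<longlonglongrightarrow> 0"
    by (rule convergence_to_attractor[OF attracting U'_open A_sub_U' U'_compact U'_sub_O]) blast
  define G where "G = K2 * (1 + R)"
  have G: "0 < G" using K2_pos R by (simp add: G_def)
  define D where "D k \<omega> = (if norm (X k \<omega>) \<le> R then a k *\<^sub>R M (Suc k) \<omega> else 0)" for k \<omega>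
  define \<zeta> where "\<zeta> m \<omega> = (\<Sum>k<m. D k \<omega>)" for m \<omega>
  have \<zeta>_diff: "\<zeta> m \<omega> - \<zeta> n \<omega> = (\<Sum>k=n..<m. D k \<omega>)" if "n \<le> m" for m n \<omega>
    using that unfolding \<zeta>_def by (induction m rule: dec_induct) simp_all
  have mart: "bounded_martingale_differences P (nat_filtr P X M) (\<lambda>k \<omega>. D k \<omega> \<bullet> b) (\<lambda>k. a k * G)"
    if "b \<in> Basis" for b
    unfolding D_def G_def
    by (rule truncated_noise_martingale)
       (use prob X_rv M_rv M_mart_diff M_bound K2_pos a_pos R that in \<open>auto simp: less_imp_le\<close>)
  have "a \<longlonglongrightarrow> 0"
    using tendsto_real_sqrt[OF summable_LIMSEQ_zero[OF a_sq_summable]] a_pos by (simp add: less_imp_le)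
  then have "\<forall>\<^sub>F k in sequentially. a k < \<delta>" using \<delta> by (rule order_tendstoD(2))
  then obtain N0 where N0: "\<And>k. N0 \<le> k \<Longrightarrow> a k < \<delta>" by (auto simp: eventually_sequentially)
  have cG: "summable (\<lambda>k. (a k * G)\<^sup>2)" using a_sq_summable by (simp add: power_mult_distrib summable_mult2)
  \<comment> \<open>Using only reciprocals of positive integers as tolerances leaves a single null
    set.\<close>
  have Cau: "AE \<omega> in P. \<forall>p. \<exists>n. \<forall>m\<ge>n. norm (\<Sum>k=n..<m. D k \<omega>) \<le> inverse (real (Suc p))"
    unfolding AE_all_countable
    by (intro allI AE_partial_sums_Cauchy[OF mart cG]) (use a_pos G in auto)
  \<comment> \<open>Read off from the maximal inequality in each coordinate at level
    \<open>\<delta> / DIM('a)\<close>, with increments bounded by \<open>a k * G\<close>.\<close>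
  define q where "q = (\<delta> / DIM('a))\<^sup>2 / 4 / G\<^sup>2"
  define Conv where "Conv = {\<omega> \<in> space P. (\<lambda>n. infdist (X n \<omega>) A) \<longlonglongrightarrow> 0}"
  have [measurable]: "(\<lambda>\<omega>. infdist (X n \<omega>) A) \<in> borel_measurable P" for n
    using X_rv by (intro borel_measurable_continuous_on[OF continuous_on_infdist]) auto
  have Conv[measurable]: "Conv \<in> sets P" unfolding Conv_def by measurable
  show ?thesis
  proof (rule exI[of _ q], intro conjI, goal_cases)
    case 1
    show "0 < q" using \<delta> G by (simp add: q_def)
  next
    case 2
    show ?case
    proof (intro exI[of _ "max 1 N0"] conjI allI ballI impI)
      fix n0 E
      assume n0: "max 1 N0 \<le> n0" and E: "E \<in> sets (nat_filtr P X M n0)"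
        and EU: "E \<subseteq> {\<omega> \<in> space P. X n0 \<omega> \<in> U'}" and PE: "0 < measure P E"
      define b where "b = (\<Sum>k. (a (k + n0))\<^sup>2)"
      have V: "0 < G\<^sup>2 * b" "\<And>m. (\<Sum>k=n0..<m. (a k * G)\<^sup>2) \<le> G\<^sup>2 * b"
      proof -
        have ps: "0 < (a k)\<^sup>2" for k using a_pos[of k] by simp
        show "0 < G\<^sup>2 * b" using suminf_tail_pos[OF a_sq_summable ps] G by (simp add: b_def)
        show "(\<Sum>k=n0..<m. (a k * G)\<^sup>2) \<le> G\<^sup>2 * b" for m
          using mult_left_mono[OF sum_le_suminf_tail[OF a_sq_summable ps, of n0 m], of "G\<^sup>2"]
          by (simp add: b_def power_mult_distrib sum_distrib_left mult.commute)
      qed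
      define Bad where "Bad = {\<omega>\<in>E. \<exists>m\<ge>n0. \<delta> \<le> norm (\<Sum>k=n0..<m. D k \<omega>)}"
      have Bad[measurable]: "Bad \<in> sets P"
        unfolding Bad_def by (rule vector_maximal_inequality(1)[OF mart E V \<delta>])
      have "measure P Bad \<le> 2 * real DIM('a) * exp (- ((\<delta> / DIM('a))\<^sup>2 / (4 * (G\<^sup>2 * b)))) * measure P E"
        unfolding Bad_def by (rule vector_maximal_inequality(2)[OF mart E V \<delta>])
      also have "(\<delta> / DIM('a))\<^sup>2 / (4 * (G\<^sup>2 * b)) = q / b" by (simp add: q_def)
      finally have Bad_le: "measure P Bad \<le> 2 * real DIM('a) * exp (- q / b) * measure P E" by simp
      have E_sets[measurable]: "E \<in> sets P"
        using E subalgebra_nat_filtr[of X P M n0] X_rv M_rv by (auto simp: subalgebra_def)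
      \<comment> \<open>The inclusion holds only off the null set where the noise fails to be
        Cauchy, hence monotonicity in its almost sure form.\<close>
      have "measure P (E - Bad) \<le> measure P (Conv \<inter> E)"
      proof (rule finite_measure_mono_AE)
        show "AE \<omega> in P. \<omega> \<in> E - Bad \<longrightarrow> \<omega> \<in> Conv \<inter> E"
          using Cau
        proof eventually_elim
          case (elim \<omega>)
          show ?case
          proof
            assume \<omega>: "\<omega> \<in> E - Bad"
            then have \<omega>P: "\<omega> \<in> space P" "X n0 \<omega> \<in> U'" using EU by auto
            have "(\<lambda>n. infdist (X n \<omega>) A) \<longlonglongrightarrow> 0"
            proof (rule conv[of a "\<lambda>k. X k \<omega>" "\<lambda>k. M k \<omega>" "\<lambda>m. \<zeta> m \<omega>" n0])
              show "\<exists>v\<in>F (X k \<omega>). X (Suc k) \<omega> = X k \<omega> + a k *\<^sub>R v + a k *\<^sub>R M (Suc k) \<omega>" for k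
                using recursion[OF \<omega>P(1), of k] by (auto simp: algebra_simps)
              show "norm (\<zeta> m \<omega> - \<zeta> n0 \<omega>) \<le> \<delta>" if "n0 \<le> m" for m
              proof -
                have "\<not> \<delta> \<le> norm (\<Sum>k=n0..<m. D k \<omega>)" using \<omega> that unfolding Bad_def by blast
                then show ?thesis using that by (simp add: \<zeta>_diff)
              qed
              show "\<exists>n. \<forall>m\<ge>n. norm (\<zeta> m \<omega> - \<zeta> n \<omega>) \<le> \<epsilon>" if "0 < \<epsilon>" for \<epsilon>
              proof -
                obtain p where "inverse (real (Suc p)) < \<epsilon>" using reals_Archimedean[OF \<open>0 < \<epsilon>\<close>] by blast
                moreover obtain n where "\<forall>m\<ge>n. norm (\<Sum>k=n..<m. D k \<omega>) \<le> inverse (real (Suc p))"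
                  using elim by blast
                ultimately show ?thesis using \<zeta>_diff by (intro exI[of _ n]) force
              qed
              show "a k \<le> \<delta>" if "n0 \<le> k" for k using N0[of k] that n0 by simp
            qed (use a_pos a_not_summable \<open>a \<longlonglongrightarrow> 0\<close> \<omega>P in \<open>auto simp: \<zeta>_def D_def\<close>)
            then show "\<omega> \<in> Conv \<inter> E" using \<omega> \<omega>P by (simp add: Conv_def)
          qed
        qed
      qed simp
      moreover have "measure P (E - Bad) = measure P E - measure P Bad"
        by (rule finite_measure_Diff[OF E_sets Bad]) (unfold Bad_def, blast)
      ultimately have "(1 - 2 * real DIM('a) * exp (- q / b)) * measure P E \<le> measure P (Conv \<inter> E)"
        using Bad_le by (simp add: algebra_simps)
      then show "1 - 2 * real DIM('a) * exp (- q / (\<Sum>k. (a (k + n0))\<^sup>2))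
          \<le> measure P ({\<omega> \<in> space P. (\<lambda>n. infdist (X n \<omega>) A) \<longlonglongrightarrow> 0} \<inter> E) / measure P E"
        using PE by (simp add: Conv_def b_def pos_le_divide_eq)
    qed simp
  qed
qed

end
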